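(* Let $N_t$ be the self-exciting point process with rate function $\lambda$ and initial condition $\gamma\ge 0$. Let $x^*$ be any unstable fixed point of $\lambda$, i.e. $x^*=\lambda(x^* )$ and $\lambda'(x^* )>1$. Then the probability that $\frac{N_t}{t}\to x^*$ as $t\to\infty$ is zero: $$\mathbb{P}\left(\lim_{t\to\infty}\frac{N_t}{t}=x^*\right)=0 .$$
   Context: Model: $\lambda:\mathbb{R}_{\ge 0}\to\mathbb{R}_{\ge 0}$ and $\gamma\ge 0$ are given; $N_t$ is a simple point process with empty past history ($N(-\infty,0]=0$) whose intensity at time $t$ with respect to its natural filtration is $\lambda_t=\lambda\left(\frac{N_{t-}+\gamma}{t+1}\right)$. Standing assumptions: $\lambda$ is increasing and continuously differentiable; the equation $x=\lambda(x)$ has finitely many solutions, and each solution $x^*$ satisfies either $\lambda'(x^* )<1$ or $\lambda'(x^* )>1$.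
   Formalization: The case x* = 0 with γ = 0 is excluded: there λ(0) = 0, so the intensity stays 0, N_t = 0 almost surely and N_t/t → 0 = x* with probability 1 (e.g. λ(x) = 2x), so the claim as stated fails. *)

theory Defs
  imports "HOL-Probability.Probability"
begin

definition left_limit :: "(real \<Rightarrow> 'b::t2_space) \<Rightarrow> real \<Rightarrow> 'b" where
  "left_limit f t = Lim (at_left t) f"

text \<open>
  A simple point process without points in \<open>(-\<infinity>, 0]\<close> is represented by its counting process:
  \<open>N t\<close> is the number of points in \<open>(0, t]\<close>. Finite values mean that it is locally finite
  (no explosion); jumps of size one mean that it is simple.
\<close>

definition simple_point_process :: "'a measure \<Rightarrow> (real \<Rightarrow> 'a \<Rightarrow> nat) \<Rightarrow> bool" where
  "simple_point_process M N \<longleftrightarrow>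
     (\<forall>t. N t \<in> measurable M (count_space UNIV)) \<and>
     (\<forall>\<omega>\<in>space M.
        (\<forall>t\<le>0. N t \<omega> = 0) \<and>
        mono (\<lambda>t. N t \<omega>) \<and>
        (\<forall>t. continuous (at_right t) (\<lambda>s. N s \<omega>)) \<and>
        (\<forall>t. N t \<omega> \<le> left_limit (\<lambda>s. N s \<omega>) t + 1))"

definition natural_filtration :: "'a measure \<Rightarrow> (real \<Rightarrow> 'a \<Rightarrow> nat) \<Rightarrow> real \<Rightarrow> 'a measure" where
  "natural_filtration M N t = sigma (space M) {N s -` B \<inter> space M | s B. s \<le> t}"

definition predictable_sigma :: "'a measure \<Rightarrow> (real \<Rightarrow> 'a measure) \<Rightarrow> (real \<times> 'a) measure" where
  "predictable_sigma M F =
     sigma ({0<..} \<times> space M) {{a<..b} \<times> A | a b A. 0 \<le> a \<and> a \<le> b \<and> A \<in> sets (F a)}"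

definition progressively_measurable :: "(real \<Rightarrow> 'a measure) \<Rightarrow> (real \<Rightarrow> 'a \<Rightarrow> real) \<Rightarrow> bool" where
  "progressively_measurable F L \<longleftrightarrow>
     (\<forall>t\<ge>0. (\<lambda>(s, \<omega>). L s \<omega>) \<in> borel_measurable (restrict_space borel {0..t} \<Otimes>\<^sub>M F t))"

definition jump_times :: "(real \<Rightarrow> nat) \<Rightarrow> real set" where
  "jump_times n = {s. 0 < s \<and> left_limit n s \<noteq> n s}"

text \<open>
  \<open>L\<close> is an \<open>F\<close>-intensity of \<open>N\<close> (Bremaud, Point Processes and Queues):
  \<open>E (\<integral> C\<^sub>s dN\<^sub>s) = E (\<integral> C\<^sub>s L\<^sub>s ds)\<close> for every nonnegative predictable \<open>C\<close>. Since \<open>N\<close> is simple,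
  the integral with respect to \<open>dN\<close> is the sum over the jump times. Testing against
  predictable processes, instead of requiring only
  \<open>E (N b - N a | F a) = E (\<integral> L\<^sub>s ds over (a, b] | F a)\<close>, keeps the notion meaningful when
  \<open>N t\<close> has infinite mean.
\<close>

definition has_intensity ::
  "'a measure \<Rightarrow> (real \<Rightarrow> 'a measure) \<Rightarrow> (real \<Rightarrow> 'a \<Rightarrow> nat) \<Rightarrow> (real \<Rightarrow> 'a \<Rightarrow> real) \<Rightarrow> bool" where
  "has_intensity M F N L \<longleftrightarrow>
     (\<forall>t. N t \<in> measurable (F t) (count_space UNIV)) \<and>
     (\<forall>t\<ge>0. \<forall>\<omega>\<in>space M. 0 \<le> L t \<omega>) \<and>
     progressively_measurable F L \<and>
     (AE \<omega> in M. \<forall>t\<ge>0. (\<integral>\<^sup>+s\<in>{0..t}. ennreal (L s \<omega>) \<partial>lborel) < \<infinity>) \<and>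
     (\<forall>C :: real \<Rightarrow> 'a \<Rightarrow> ennreal.
        (\<lambda>(s, \<omega>). C s \<omega>) \<in> borel_measurable (predictable_sigma M F) \<longrightarrow>
        (\<integral>\<^sup>+\<omega>. (\<integral>\<^sup>+s. C s \<omega> \<partial>count_space (jump_times (\<lambda>t. N t \<omega>))) \<partial>M) =
        (\<integral>\<^sup>+\<omega>. (\<integral>\<^sup>+s\<in>{0<..}. C s \<omega> * ennreal (L s \<omega>) \<partial>lborel) \<partial>M))"

definition self_exciting_point_process ::
  "'a measure \<Rightarrow> (real \<Rightarrow> real) \<Rightarrow> real \<Rightarrow> (real \<Rightarrow> 'a \<Rightarrow> nat) \<Rightarrow> bool" where
  "self_exciting_point_process M lam \<gamma> N \<longleftrightarrow>
     simple_point_process M N \<and>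
     has_intensity M (natural_filtration M N) N
       (\<lambda>t \<omega>. lam ((real (left_limit (\<lambda>s. N s \<omega>) t) + \<gamma>) / (t + 1)))"

end

theory Submission
  imports Defs
begin

text \<open>
  Write \<open>v = t + 1\<close>, \<open>X = (N + \<gamma>) / v\<close> and \<open>y = v (X - x)\<close> for the unstable fixed point \<open>x\<close>. It suffices
  to show that for small \<open>\<epsilon>\<close> the process \<open>X\<close> almost surely does not stay in \<open>[x - \<epsilon>, x + \<epsilon>]\<close> from some
  time \<open>T\<close> on. For this we use a Lyapunov function \<open>f t k\<close> of time and state that is bounded above on
  this region and whose drift \<open>\<partial>\<^sub>t f + \<lambda>(X) (f t (k + 1) - f t k)\<close> is at least \<open>\<delta> / (t + 1)\<close> there.
  Stopping at the exit from the region, the compensator formula gives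
  \<open>\<delta> P(X stays in the region during [T, t]) ln ((t + 1) / (T + 1)) \<le> sup f - inf f T\<close>, and the
  logarithm diverges. For \<open>x > 0\<close> one takes
  \<open>f = ln (q + 1) / 2 - B exp (- \<theta> q) - ln v / 2\<close> with \<open>q = y\<^sup>2 / v\<close>, essentially \<open>ln \<bar>X - x\<bar>\<close> regularised
  on the diffusive scale. For \<open>x = 0\<close> there is no noise at the fixed point, but then \<open>\<gamma> > 0\<close> and
  \<open>f = ln y - 1 / y - ln v\<close> works.
\<close>

subsection \<open>Drift of the Lyapunov functions\<close>

lemma exp_le_quadratic:
  fixes w :: real
  assumes "\<bar>w\<bar> \<le> 1"
  shows "exp w \<le> 1 + w + w\<^sup>2"
proof (cases "0 \<le> w")
  case True
  thus ?thesis using assms by (intro exp_bound) auto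
next
  case False
  \<comment> \<open>For \<open>w < 0\<close> it suffices that
    \<open>1 \<le> (1 + w + w\<^sup>2) * exp (- w)\<close>; here
    \<open>exp (- w) \<ge> 1 - w\<close>, and the product with \<open>1 - w\<close>
    telescopes.\<close>
  have "1 \<le> 1 - w ^ 3" using False by (simp add: power_less_zero_eq)
  also have "\<dots> = (1 + w + w\<^sup>2) * (1 - w)" by (simp add: algebra_simps power2_eq_square power3_eq_cube)
  also have "\<dots> \<le> (1 + w + w\<^sup>2) * exp (- w)"
  proof (rule mult_left_mono)
    show "1 - w \<le> exp (- w)" using exp_ge_add_one_self[of "- w"] by simp
    have "0 \<le> 1 + w" using assms by linarith
    thus "0 \<le> 1 + w + w\<^sup>2" by simp
  qed
  finally show ?thesis by (simp add: exp_minus field_simps)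
qed

text \<open>This is the drift of \<open>- exp (- \<theta> * q)\<close> divided by
  \<open>exp (- \<theta> * q)\<close>: \<open>d\<close> is the increment of \<open>q\<close> when
  \<open>y\<close> jumps to \<open>y + 1\<close>, and the last bracket is the time derivative of
  \<open>q\<close>. The first-order drift of \<open>q\<close> is
  \<open>(2 * (l - x) * y + l - q) / v\<close>, where \<open>l\<close>, close to
  \<open>x > 0\<close>, comes from the noise; \<open>\<theta>\<close> is small enough for the
  second-order loss to consume only part of it.\<close>

lemma drift_exp_part:
  fixes x b v y l :: real
  assumes "0 < x" "1 < b" "0 < v" "1 / v \<le> x / 4" "\<bar>y\<bar> / v \<le> x / 4"
    and l: "\<bar>l - x\<bar> \<le> x / 4" "b * (y\<^sup>2 / v) \<le> (l - x) * y"
  defines "\<theta> \<equiv> 1 / (16 * x)" and "q \<equiv> y\<^sup>2 / v" and "d \<equiv> (2 * y + 1) / v"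
  shows "1 / (32 * v) \<le> l * (1 - exp (- \<theta> * d)) + \<theta> * (- 2 * x * y / v - y\<^sup>2 / v\<^sup>2)"
proof -
  have q0: "0 \<le> q" using assms by (simp add: q_def)
  have \<theta>: "0 < \<theta>" "\<theta> * x = 1 / 16" using assms(1) by (auto simp: \<theta>_def)
  have ll: "3 / 4 * x \<le> l" "l \<le> 5 / 4 * x" using l(1) by linarith+
  have d: "\<bar>d\<bar> \<le> x"
  proof -
    have "\<bar>d\<bar> \<le> 2 * (\<bar>y\<bar> / v) + 1 / v"
      using assms(3) unfolding d_def by (auto simp: abs_divide add_divide_distrib[symmetric] intro!: divide_right_mono)
    thus ?thesis using assms by linarith
  qed
  have "\<bar>- \<theta> * d\<bar> \<le> \<theta> * x" using d \<theta> by (simp add: abs_mult)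
  hence "exp (- \<theta> * d) \<le> 1 + (- \<theta> * d) + (- \<theta> * d)\<^sup>2"
    using \<theta> by (intro exp_le_quadratic) simp
  hence e: "\<theta> * d - \<theta>\<^sup>2 * d\<^sup>2 \<le> 1 - exp (- \<theta> * d)" by (simp add: power_mult_distrib)
  have vd: "v * d\<^sup>2 \<le> 4 * q + 5 / 4 * x"
  proof -
    have "v * d\<^sup>2 = 4 * q + 4 * (y / v) + 1 / v"
      using assms(3) by (simp add: d_def q_def power2_eq_square field_simps)
    moreover have "y / v \<le> \<bar>y\<bar> / v" using assms(3) by (intro divide_right_mono) auto
    ultimately show ?thesis using assms by linarith
  qed
  have A: "v * (l * d + (- 2 * x * y / v - y\<^sup>2 / v\<^sup>2)) = 2 * ((l - x) * y) + l - q"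
    using assms(3) by (simp add: d_def q_def power2_eq_square field_simps)
  have "\<theta> * l \<le> \<theta> * (5 / 4 * x)" using ll(2) \<theta>(1) by (intro mult_left_mono) auto
  also have "\<dots> = 5 / 4 * (\<theta> * x)" by simp
  finally have "\<theta> * l \<le> 5 / 64" using \<theta>(2) by simp
  moreover have "0 \<le> \<theta> * l" using \<theta> ll assms(1) by simp
  ultimately have "(\<theta> * l) * (v * d\<^sup>2) \<le> 5 / 64 * (4 * q + 5 / 4 * x)"
    using vd q0 assms by (intro mult_mono) auto
  \<comment> \<open>Instability contributes \<open>2 * b * q \<ge> 2 * q\<close>, which covers
    \<open>- q\<close> and the loss \<open>5 / 16 * q\<close>; of \<open>l \<ge> 3 / 4 * x\<close>
    at least \<open>x / 2\<close> survives the remaining loss.\<close>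
  moreover have "q \<le> b * q" using q0 assms(2) by (simp add: mult_le_cancel_right1)
  ultimately have "x / 2 \<le> 2 * ((l - x) * y) + l - q - (\<theta> * l) * (v * d\<^sup>2)"
    using l(2) ll q0 assms(1) unfolding q_def[symmetric] by (simp add: algebra_simps)
  hence "\<theta> * (x / 2) \<le> \<theta> * (v * (l * d + (- 2 * x * y / v - y\<^sup>2 / v\<^sup>2)) - (\<theta> * l) * (v * d\<^sup>2))"
    using \<theta>(1) unfolding A by (intro mult_left_mono) auto
  also have "\<dots> = v * (l * (\<theta> * d - \<theta>\<^sup>2 * d\<^sup>2) + \<theta> * (- 2 * x * y / v - y\<^sup>2 / v\<^sup>2))"
    by (simp add: algebra_simps power2_eq_square)
  also have "\<dots> \<le> v * (l * (1 - exp (- \<theta> * d)) + \<theta> * (- 2 * x * y / v - y\<^sup>2 / v\<^sup>2))"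
    using assms(1,3) ll e by (intro mult_left_mono add_right_mono) auto
  finally have "1 / 32 \<le> v * (l * (1 - exp (- \<theta> * d)) + \<theta> * (- 2 * x * y / v - y\<^sup>2 / v\<^sup>2))"
    using \<theta> by simp
  moreover have "1 / (32 * v) \<le> r" if "1 / 32 \<le> v * r" for r
    using that assms(3) by (simp add: field_simps)
  ultimately show ?thesis by blast
qed

text \<open>A jump multiplies \<open>q + 1\<close> by \<open>1 + w\<close> with \<open>w\<close>
  small, and \<open>ln (1 + w) \<ge> w - 2 * w\<^sup>2\<close> leaves the first-order drift and a
  second-order loss. \<open>C0\<close> bounds that loss: \<open>2 * l \<le> 5 / 2 * x\<close> times
  \<open>v * d\<^sup>2 / (q + 1) \<le> 4 + 5 / 4 * x\<close>.\<close>

lemma drift_log_part: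
  fixes x b v y l :: real
  assumes "0 < x" "1 < b" "0 < v" "1 / v \<le> x / 4" "1 / v \<le> 1 / 4" "\<bar>y\<bar> / v \<le> x / 4" "\<bar>y\<bar> / v \<le> 1 / 8"
    and l: "\<bar>l - x\<bar> \<le> x / 4" "b * (y\<^sup>2 / v) \<le> (l - x) * y"
  defines "q \<equiv> y\<^sup>2 / v" and "C0 \<equiv> 5 / 2 * x * (4 + 5 / 4 * x)"
  shows "((2 * b - 1) * q - C0) / (q + 1) / v \<le>
    l * (ln ((y + 1)\<^sup>2 / v + 1) - ln (q + 1)) + (- 2 * x * y / v - y\<^sup>2 / v\<^sup>2) / (q + 1)"
proof -
  define d where "d = (2 * y + 1) / v"
  define p where "p = - 2 * x * y / v - y\<^sup>2 / v\<^sup>2"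
  define w where "w = d / (q + 1)"
  have q0: "0 \<le> q" using assms by (simp add: q_def)
  have ll: "3 / 4 * x \<le> l" "l \<le> 5 / 4 * x" using l(1) by linarith+
  have d: "\<bar>d\<bar> \<le> 1 / 2"
  proof -
    have "\<bar>d\<bar> \<le> 2 * (\<bar>y\<bar> / v) + 1 / v"
      using assms(3) unfolding d_def by (auto simp: abs_divide add_divide_distrib[symmetric] intro!: divide_right_mono)
    thus ?thesis using assms by linarith
  qed
  have "\<bar>w\<bar> \<le> \<bar>d\<bar>" unfolding w_def using q0 by (simp add: abs_divide divide_le_eq mult_le_cancel_left1)
  hence w: "\<bar>w\<bar> \<le> 1 / 2" using d by simp
  have "(y + 1)\<^sup>2 / v + 1 = (q + 1) * (1 + w)"
  proof -
    have "(q + 1) * w = d" using q0 by (simp add: w_def)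
    hence "(q + 1) * (1 + w) = q + 1 + d" by (simp add: distrib_left)
    moreover have "(y + 1)\<^sup>2 / v = q + d"
      by (simp add: q_def d_def power2_eq_square add_divide_distrib[symmetric] algebra_simps)
    ultimately show ?thesis by simp
  qed
  hence lnw: "ln ((y + 1)\<^sup>2 / v + 1) - ln (q + 1) = ln (1 + w)"
    using q0 w by (simp add: ln_mult)
  have ln_ge: "w - 2 * w\<^sup>2 \<le> ln (1 + w)"
    using abs_ln_one_plus_x_minus_x_bound[OF w] by linarith
  have vd: "v * d\<^sup>2 \<le> 4 * q + 5 / 4 * x"
  proof -
    have "v * d\<^sup>2 = 4 * q + 4 * (y / v) + 1 / v"
      using assms(3) by (simp add: d_def q_def power2_eq_square field_simps)
    moreover have "y / v \<le> \<bar>y\<bar> / v" using assms(3) by (intro divide_right_mono) auto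
    ultimately show ?thesis using assms by linarith
  qed
  have A: "v * (l * d + p) = 2 * ((l - x) * y) + l - q"
    using assms(3) by (simp add: d_def p_def q_def power2_eq_square field_simps)
  have "v * d\<^sup>2 / (q + 1) \<le> 4 + 5 / 4 * x"
  proof -
    have "(4 + 5 / 4 * x) * (q + 1) = 4 * q + 5 / 4 * x + (4 + 5 / 4 * (x * q))"
      by (simp add: algebra_simps)
    moreover have "0 \<le> x * q" using q0 assms(1) by simp
    ultimately have "4 * q + 5 / 4 * x \<le> (4 + 5 / 4 * x) * (q + 1)" by linarith
    thus ?thesis using vd q0 by (simp add: divide_le_eq)
  qed
  hence "2 * l * (v * d\<^sup>2 / (q + 1)) \<le> 2 * (5 / 4 * x) * (4 + 5 / 4 * x)"
    using ll assms(1,3) q0 by (intro mult_mono) auto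
  hence "(2 * b - 1) * q - C0 \<le> v * (l * d + p) - 2 * l * (v * d\<^sup>2 / (q + 1))"
    using l(2) ll assms(1) unfolding A q_def[symmetric] C0_def by (simp add: algebra_simps)
  hence "((2 * b - 1) * q - C0) / (q + 1) / v \<le> (v * (l * d + p) - 2 * l * (v * d\<^sup>2 / (q + 1))) / (q + 1) / v"
    using q0 assms(3) by (intro divide_right_mono) auto
  also have "\<dots> = l * (w - 2 * w\<^sup>2) + p / (q + 1)"
  proof -
    have "(v * (l * d + p) - 2 * l * (v * d\<^sup>2 / c)) / c / v = l * (d / c - 2 * (d / c)\<^sup>2) + p / c"
      if "0 < c" for c
      using assms(3) that by (simp add: field_simps power2_eq_square)
    from this[of "q + 1"] show ?thesis using q0 by (simp add: w_def)
  qed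
  also have "\<dots> \<le> l * ln (1 + w) + p / (q + 1)"
    using ln_ge ll assms(1) by (intro add_right_mono mult_left_mono) auto
  finally show ?thesis unfolding lnw p_def .
qed

text \<open>\<open>Q\<close> solves \<open>(b - 1) * Q = C0 + b\<close>, so for
  \<open>q \<ge> Q\<close> the fraction alone is at least \<open>b\<close>. For \<open>q < Q\<close>
  it can only be bounded by \<open>- C0\<close>; the factor \<open>exp (\<theta> * Q)\<close> in
  \<open>B\<close> lets the exponential still pay for this and for the \<open>- 1 / 2\<close>
  stemming from \<open>- ln v / 2\<close>.\<close>

lemma drift_total:
  fixes b q C0 :: real
  assumes "1 < b" "0 \<le> q" "0 \<le> C0" "0 \<le> \<theta>"
  defines "Q \<equiv> (C0 + 1) / (b - 1) + 1"
  defines "B \<equiv> 32 * exp (\<theta> * Q) * ((C0 + 1) / 2 + (b - 1) / 2)"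
  shows "(b - 1) / 2 \<le> ((2 * b - 1) * q - C0) / (q + 1) / 2 - 1 / 2 + B * exp (- \<theta> * q) / 32"
proof (cases "Q \<le> q")
  case True
  have "(C0 + 1) + (b - 1) = (b - 1) * Q" using assms(1) by (simp add: Q_def field_simps)
  also have "\<dots> \<le> (b - 1) * q" using True assms(1) by (intro mult_left_mono) auto
  finally have "b * (q + 1) \<le> (2 * b - 1) * q - C0" by (simp add: algebra_simps)
  hence "b \<le> ((2 * b - 1) * q - C0) / (q + 1)" using assms(2) by (simp add: le_divide_eq)
  moreover have "0 \<le> B * exp (- \<theta> * q) / 32" using assms by (simp add: B_def)
  moreover have "(b - 1) / 2 \<le> r / 2 - 1 / 2 + e" if "b \<le> r" "0 \<le> e" for r e
    using that by simp
  ultimately show ?thesis by blast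
next
  case False
  have "- C0 * (q + 1) \<le> (2 * b - 1) * q - C0"
  proof -
    have "0 \<le> (2 * b - 1) * q + C0 * q" using assms by (intro add_nonneg_nonneg mult_nonneg_nonneg) auto
    thus ?thesis by (simp add: algebra_simps)
  qed
  hence 1: "- C0 \<le> ((2 * b - 1) * q - C0) / (q + 1)" using assms(2) by (simp add: le_divide_eq)
  have "1 \<le> exp (\<theta> * (Q - q))" using False assms(4) by simp
  hence "1 * ((C0 + 1) / 2 + (b - 1) / 2) \<le> exp (\<theta> * (Q - q)) * ((C0 + 1) / 2 + (b - 1) / 2)"
    using assms by (intro mult_right_mono) auto
  also have "\<dots> = B * exp (- \<theta> * q) / 32"
    by (simp add: B_def right_diff_distrib exp_diff exp_minus field_simps)
  finally show ?thesis using 1 by argo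
qed

text \<open>
  With \<open>v = s + 1\<close> and \<open>y = k + \<gamma> - x v\<close>, the variable \<open>q = y\<^sup>2 / v\<close> is the squared deviation on the
  diffusive scale. The logarithm only has positive drift for large \<open>q\<close>; the bounded term
  \<open>- B exp (- \<theta> q)\<close> compensates for small \<open>q\<close>, where the noise dominates.
\<close>

definition lyap :: "real \<Rightarrow> real \<Rightarrow> real \<Rightarrow> real" where
  "lyap B \<theta> q = ln (q + 1) / 2 - B * exp (- \<theta> * q)"

text \<open>The right-hand side is the drift of \<open>lyap B \<theta> q - ln v / 2\<close>: chain
  rule in time plus rate times jump. It is estimated by half of \<open>drift_log_part\<close> plus
  \<open>B * exp (- \<theta> * q)\<close> times \<open>drift_exp_part\<close>, balanced by
  \<open>drift_total\<close>.\<close>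

lemma lyap_drift:
  fixes x b v y l :: real
  assumes "0 < x" "1 < b" "0 < v" "1 / v \<le> x / 4" "1 / v \<le> 1 / 4" "\<bar>y\<bar> / v \<le> x / 4" "\<bar>y\<bar> / v \<le> 1 / 8"
    and l: "\<bar>l - x\<bar> \<le> x / 4" "b * (y\<^sup>2 / v) \<le> (l - x) * y"
  defines "q \<equiv> y\<^sup>2 / v" and "C0 \<equiv> 5 / 2 * x * (4 + 5 / 4 * x)" and "\<theta> \<equiv> 1 / (16 * x)"
  defines "Q \<equiv> (C0 + 1) / (b - 1) + 1"
  defines "B \<equiv> 32 * exp (\<theta> * Q) * ((C0 + 1) / 2 + (b - 1) / 2)"
  shows "(b - 1) / 2 / v \<le>
    (1 / (2 * (q + 1)) + B * \<theta> * exp (- \<theta> * q)) * (- 2 * x * y / v - y\<^sup>2 / v\<^sup>2) - 1 / (2 * v) +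
    l * (lyap B \<theta> ((y + 1)\<^sup>2 / v) - lyap B \<theta> q)"
proof -
  define p where "p = - 2 * x * y / v - y\<^sup>2 / v\<^sup>2"
  define d where "d = (2 * y + 1) / v"
  have C0: "0 \<le> C0" using assms(1) by (simp add: C0_def)
  have q0: "0 \<le> q" using assms(3) by (simp add: q_def)
  have B0: "0 \<le> B" using C0 assms(2) by (simp add: B_def)
  have q1: "(y + 1)\<^sup>2 / v = q + d"
    by (simp add: q_def d_def power2_eq_square add_divide_distrib[symmetric] algebra_simps)
  have e: "1 / (32 * v) \<le> l * (1 - exp (- \<theta> * d)) + \<theta> * p"
    using drift_exp_part[of x b v y l] assms unfolding p_def d_def by simp
  have g: "((2 * b - 1) * q - C0) / (q + 1) / v \<le> l * (ln (q + d + 1) - ln (q + 1)) + p / (q + 1)"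
    using drift_log_part[of x b v y l] assms(1-9) q1 unfolding p_def q_def C0_def by simp
  have "(b - 1) / 2 \<le> ((2 * b - 1) * q - C0) / (q + 1) / 2 - 1 / 2 + B * exp (- \<theta> * q) / 32"
    unfolding B_def Q_def using assms(1,2) q0 C0 by (intro drift_total) (auto simp: \<theta>_def)
  hence "(b - 1) / 2 / v \<le> (((2 * b - 1) * q - C0) / (q + 1) / 2 - 1 / 2 + B * exp (- \<theta> * q) / 32) / v"
    using assms(3) by (intro divide_right_mono) auto
  also have "\<dots> = (((2 * b - 1) * q - C0) / (q + 1) / v) / 2 - 1 / (2 * v) + B * exp (- \<theta> * q) * (1 / (32 * v))"
  proof -
    have "(r / 2 - 1 / 2 + e / 32) / v = r / v / 2 - 1 / (2 * v) + e * (1 / (32 * v))" for r e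
      using assms(3) by (simp add: field_simps)
    thus ?thesis .
  qed
  also have "\<dots> \<le> (l * (ln (q + d + 1) - ln (q + 1)) + p / (q + 1)) / 2 - 1 / (2 * v) +
      B * exp (- \<theta> * q) * (l * (1 - exp (- \<theta> * d)) + \<theta> * p)"
    using g e B0 assms(3) by (intro add_mono diff_mono divide_right_mono mult_left_mono) auto
  also have "\<dots> = (1 / (2 * (q + 1)) + B * \<theta> * exp (- \<theta> * q)) * p - 1 / (2 * v) +
    l * (lyap B \<theta> (q + d) - lyap B \<theta> q)"
  proof -
    have "exp (- \<theta> * (q + d)) = exp (- \<theta> * q) * exp (- \<theta> * d)" by (simp add: distrib_left mult_exp_exp)
    moreover have "p / (q + 1) / 2 = 1 / (2 * (q + 1)) * p" by simp
    ultimately show ?thesis by (simp add: lyap_def add_divide_distrib) (simp add: algebra_simps diff_divide_distrib add_divide_distrib)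
  qed
  finally show ?thesis unfolding q1 p_def .
qed

text \<open>A jump gains at least \<open>1 / (y + 1)\<close> from \<open>ln\<close> and exactly
  \<open>1 / y - 1 / (y + 1)\<close> from the correction \<open>- 1 / y\<close>, in total at least
  \<open>1 / y\<close>. Since the rate is at least \<open>b * y / v\<close>, the jumps contribute
  \<open>b / v\<close>.\<close>

lemma log_drift_at_zero:
  fixes y l b v :: real
  assumes "0 < y" "0 < v" "b * (y / v) \<le> l" "0 \<le> l"
  shows "(b - 1) / v \<le> - 1 / v + l * ((ln (y + 1) - 1 / (y + 1)) - (ln y - 1 / y))"
proof -
  have "ln (y / (y + 1)) \<le> y / (y + 1) - 1" using assms(1) by (intro ln_le_minus_one) auto
  also have "y / (y + 1) - 1 = - 1 / (y + 1)" using assms(1) by (simp add: field_simps)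
  finally have "1 / y \<le> (ln (y + 1) - 1 / (y + 1)) - (ln y - 1 / y)"
    using assms(1) by (simp add: ln_div)
  hence "l * (1 / y) \<le> l * ((ln (y + 1) - 1 / (y + 1)) - (ln y - 1 / y))"
    using assms(4) by (rule mult_left_mono)
  moreover have "b / v \<le> l * (1 / y)" using assms by (simp add: field_simps)
  ultimately show ?thesis by (simp add: diff_divide_distrib)
qed

lemma lyap_has_derivative:
  assumes "0 \<le> q"
  shows "(lyap B \<theta> has_real_derivative 1 / (2 * (q + 1)) + B * \<theta> * exp (- \<theta> * q)) (at q)"
  unfolding lyap_def using assms
  by (auto intro!: derivative_eq_intros simp: field_simps)

subsection \<open>Paths of counting processes\<close>

text \<open>Only one summand has to be measurable: sums over jump times are not shown to be.\<close>

lemma nn_integral_add_left_measurable: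
  fixes f g :: "'a \<Rightarrow> ennreal"
  assumes [measurable]: "g \<in> borel_measurable M"
  shows "(\<integral>\<^sup>+x. g x + f x \<partial>M) = (\<integral>\<^sup>+x. g x \<partial>M) + (\<integral>\<^sup>+x. f x \<partial>M)"
proof (rule antisym)
  show "(\<integral>\<^sup>+x. g x + f x \<partial>M) \<le> (\<integral>\<^sup>+x. g x \<partial>M) + (\<integral>\<^sup>+x. f x \<partial>M)"
    unfolding nn_integral_def_finite[of M "\<lambda>x. g x + f x"]
  proof (rule SUP_least)
    fix u assume "u \<in> {u. simple_function M u \<and> u \<le> (\<lambda>x. g x + f x) \<and> (\<forall>x. u x < top)}"
    hence u: "simple_function M u" "\<And>x. u x \<le> g x + f x" "\<And>x. u x < top" by (auto simp: le_fun_def)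
    have [measurable]: "u \<in> borel_measurable M" by (rule borel_measurable_simple_function[OF u(1)])
    have "integral\<^sup>S M u = (\<integral>\<^sup>+x. u x \<partial>M)" using u(1) by (rule nn_integral_eq_simple_integral[symmetric])
    \<comment> \<open>\<open>u\<close> is split by truncated subtraction: \<open>u - g\<close> is
      measurable and at most \<open>f\<close>. Finiteness of \<open>u\<close> excludes the
      exceptional case \<open>top - top = top\<close>.\<close>
    also have "\<dots> \<le> (\<integral>\<^sup>+x. g x + (u x - g x) \<partial>M)"
    proof (rule nn_integral_mono)
      fix x
      show "u x \<le> g x + (u x - g x)"
        by (cases "g x \<le> u x") (simp_all add: add_diff_inverse_ennreal add_increasing2)
    qed
    also have "\<dots> = (\<integral>\<^sup>+x. g x \<partial>M) + (\<integral>\<^sup>+x. u x - g x \<partial>M)"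
      by (intro nn_integral_add) auto
    also have "(\<integral>\<^sup>+x. u x - g x \<partial>M) \<le> (\<integral>\<^sup>+x. f x \<partial>M)"
      using u by (intro nn_integral_mono) (auto simp: ennreal_minus_le_iff less_top[symmetric])
    finally show "integral\<^sup>S M u \<le> (\<integral>\<^sup>+x. g x \<partial>M) + (\<integral>\<^sup>+x. f x \<partial>M)" by (simp add: add_left_mono)
  qed
  have "(\<integral>\<^sup>+x. f x \<partial>M) + (\<integral>\<^sup>+x. g x \<partial>M) =
    (SUP u\<in>{u. simple_function M u \<and> u \<le> f}. integral\<^sup>S M u + (\<integral>\<^sup>+x. g x \<partial>M))"
    unfolding nn_integral_def[of M f]
    by (intro ennreal_SUP_add_left[symmetric]) (auto intro!: exI[of _ "\<lambda>_. 0"] simp: le_fun_def)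
  also have "\<dots> \<le> (\<integral>\<^sup>+x. g x + f x \<partial>M)"
  proof (rule SUP_least)
    fix u assume "u \<in> {u. simple_function M u \<and> u \<le> f}"
    hence u: "simple_function M u" "\<And>x. u x \<le> f x" by (auto simp: le_fun_def)
    have [measurable]: "u \<in> borel_measurable M" by (rule borel_measurable_simple_function[OF u(1)])
    have "integral\<^sup>S M u + (\<integral>\<^sup>+x. g x \<partial>M) = (\<integral>\<^sup>+x. u x + g x \<partial>M)"
      using u(1) by (simp add: nn_integral_add nn_integral_eq_simple_integral)
    also have "\<dots> \<le> (\<integral>\<^sup>+x. g x + f x \<partial>M)"
      using u(2) by (intro nn_integral_mono) (simp add: add.commute add_left_mono)
    finally show "integral\<^sup>S M u + (\<integral>\<^sup>+x. g x \<partial>M) \<le> (\<integral>\<^sup>+x. g x + f x \<partial>M)" .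
  qed
  finally show "(\<integral>\<^sup>+x. g x \<partial>M) + (\<integral>\<^sup>+x. f x \<partial>M) \<le> (\<integral>\<^sup>+x. g x + f x \<partial>M)" by (simp add: add.commute)
qed

section \<open>Left limits of monotone integer-valued paths and the change of a function along
  them\<close>

lemma left_limit_mono_nat:
  fixes n :: "real \<Rightarrow> nat"
  assumes "mono n"
  obtains r where "r < s" "\<And>u. r \<le> u \<Longrightarrow> u < s \<Longrightarrow> n u = left_limit n s"
proof -
  \<comment> \<open>The values before \<open>s\<close> are naturals bounded by \<open>n s\<close>,
    so they have a maximum; once it is attained, monotonicity keeps the path constant up to
    \<open>s\<close>.\<close>
  define m where "m = Max (n ` {..<s})"
  have fin: "finite (n ` {..<s})"
    by (rule finite_subset[of _ "{..n s}"]) (auto intro: monoD[OF assms])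
  have ne: "n ` {..<s} \<noteq> {}" by simp
  from Max_in[OF fin ne] obtain r where r: "r < s" "n r = m" unfolding m_def by auto
  have eq: "n u = m" if "r \<le> u" "u < s" for u
    using monoD[OF assms that(1)] r Max_ge[OF fin, of "n u"] that by (auto simp: m_def)
  have "eventually (\<lambda>u. n u = m) (at_left s)"
    using eventually_at_left_field[of "\<lambda>u. n u = m" s] r(1) eq by force
  hence "(n \<longlongrightarrow> m) (at_left s)" by (rule tendsto_eventually)
  hence "left_limit n s = m" unfolding left_limit_def
    by (intro tendsto_Lim) auto
  with eq r(1) that show ?thesis by auto
qed

lemma left_limit_eqI:
  fixes n :: "real \<Rightarrow> nat"
  assumes "mono n" "a < s" "\<And>u. a \<le> u \<Longrightarrow> u < s \<Longrightarrow> n u = k"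
  shows "left_limit n s = k"
proof -
  obtain r where "r < s" "\<And>u. r \<le> u \<Longrightarrow> u < s \<Longrightarrow> n u = left_limit n s"
    using left_limit_mono_nat[OF assms(1), of s] by blast
  from this(2)[of "max a r"] assms(3)[of "max a r"] this(1) assms(2) show ?thesis by auto
qed

text \<open>Only countably many times occur on the right, which is what makes left limits
  predictable.\<close>

lemma left_limit_ge_iff:
  fixes n :: "real \<Rightarrow> nat"
  assumes "mono n" "0 < s"
  shows "k \<le> left_limit n s \<longleftrightarrow> (\<exists>r\<in>\<rat>. 0 \<le> r \<and> r < s \<and> k \<le> n r)"
proof -
  obtain r where r: "r < s" "\<And>u. r \<le> u \<Longrightarrow> u < s \<Longrightarrow> n u = left_limit n s"
    using left_limit_mono_nat[OF assms(1), of s] by blast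
  show ?thesis
  proof
    assume k: "k \<le> left_limit n s"
    have "max r 0 < s" using r assms by auto
    from Rats_dense_in_real[OF this] obtain q where "q \<in> \<rat>" "max r 0 < q" "q < s" by blast
    thus "\<exists>r\<in>\<rat>. 0 \<le> r \<and> r < s \<and> k \<le> n r" using r(2)[of q] k by (intro bexI[of _ q]) auto
  next
    assume "\<exists>r\<in>\<rat>. 0 \<le> r \<and> r < s \<and> k \<le> n r"
    then obtain q where q: "q < s" "k \<le> n q" by blast
    have "n q \<le> n (max r q)" by (rule monoD[OF assms(1)]) simp
    also have "\<dots> = left_limit n s" using r q by (intro r(2)) auto
    finally show "k \<le> left_limit n s" using q by simp
  qed
qed

lemma left_limit_le:
  fixes n :: "real \<Rightarrow> nat"
  assumes "mono n"
  shows "left_limit n s \<le> n s"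
proof -
  obtain r where "r < s" "\<And>u. r \<le> u \<Longrightarrow> u < s \<Longrightarrow> n u = left_limit n s"
    using left_limit_mono_nat[OF assms(1), of s] by blast
  from this(2)[of r] this(1) monoD[OF assms, of r s] show ?thesis by auto
qed

text \<open>The sign is not assumed at \<open>a\<close>, where in the application the left limit may
  still belong to an earlier state; it follows there by continuity.\<close>

lemma nn_integral_FTC_Ioc:
  fixes F F' :: "real \<Rightarrow> real"
  assumes "a < b"
    and deriv: "\<And>s. a \<le> s \<Longrightarrow> s \<le> b \<Longrightarrow> (F has_real_derivative F' s) (at s)"
    and cont: "continuous_on {a..b} F'"
    and nonneg: "\<And>s. a < s \<Longrightarrow> s \<le> b \<Longrightarrow> 0 \<le> F' s"
  shows "F a \<le> F b" "(\<integral>\<^sup>+s\<in>{a<..b}. ennreal (F' s) \<partial>lborel) = ennreal (F b - F a)"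
proof -
  have nonneg': "0 \<le> F' s" if "s \<in> {a..b}" for s
  proof (rule continuous_ge_on_closure[of "{a<..b}" F' s 0])
    have cl: "closure {a<..b} = {a..b}" using assms(1) by simp
    show "continuous_on (closure {a<..b}) F'" "s \<in> closure {a<..b}" using cont that cl by auto
  qed (use nonneg in auto)
  define g where "g s = (if s \<in> {a..b} then F' s else 0)" for s
  have gm: "g \<in> borel_measurable borel" unfolding g_def
    by (intro borel_measurable_continuous_on_if cont) auto
  have "(\<integral>\<^sup>+s. ennreal (g s) * indicator {a..b} s \<partial>lborel) = ennreal (F b - F a)"
  proof (rule nn_integral_FTC_Icc[OF gm])
    show "(F has_real_derivative g s) (at s)" "0 \<le> g s" if "s \<in> {a..b}" for s
      using deriv[of s] nonneg'[of s] that by (auto simp: g_def)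
  qed (use assms(1) in simp)
  also have "(\<integral>\<^sup>+s. ennreal (g s) * indicator {a..b} s \<partial>lborel) =
      (\<integral>\<^sup>+s\<in>{a<..b}. ennreal (F' s) \<partial>lborel)"
    using AE_lborel_singleton[of a]
    by (intro nn_integral_cong_AE) (auto simp: g_def indicator_def elim!: eventually_mono)
  finally show "(\<integral>\<^sup>+s\<in>{a<..b}. ennreal (F' s) \<partial>lborel) = ennreal (F b - F a)" .
  show "F a \<le> F b"
  proof (rule DERIV_nonneg_imp_nondecreasing[of a b F])
    show "\<exists>y. (F has_real_derivative y) (at s) \<and> 0 \<le> y" if "a \<le> s" "s \<le> b" for s
      using deriv[OF that] nonneg'[of s] that by auto
  qed (use assms(1) in simp)
qed

text \<open>The drift part is kept nonnegative so that it can be an extended nonnegative integral.\<close>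

lemma counting_path_change:
  fixes n :: "real \<Rightarrow> nat" and f f' :: "real \<Rightarrow> nat \<Rightarrow> real"
  assumes "mono n"
    and rc: "\<And>t. continuous (at_right t) n"
    and jump: "\<And>t. n t \<le> left_limit n t + 1"
    and "0 \<le> a" "a \<le> b"
    and deriv: "\<And>k s. a \<le> s \<Longrightarrow> s \<le> b \<Longrightarrow> ((\<lambda>s. f s k) has_real_derivative f' s k) (at s)"
    and cont: "\<And>k. continuous_on {a..b} (\<lambda>s. f' s k)"
    and nonneg: "\<And>s. a < s \<Longrightarrow> s \<le> b \<Longrightarrow> 0 \<le> f' s (left_limit n s)"
  shows "finite (jump_times n \<inter> {a<..b})"
    and "\<exists>G\<ge>0. (\<integral>\<^sup>+s\<in>{a<..b}. ennreal (f' s (left_limit n s)) \<partial>lborel) = ennreal G \<and>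
       f b (n b) - f a (n a) = G + (\<Sum>s\<in>jump_times n \<inter> {a<..b}.
         f s (Suc (left_limit n s)) - f s (left_limit n s))"
proof -
  define I where "I a b = (\<integral>\<^sup>+s\<in>{a<..b}. ennreal (f' s (left_limit n s)) \<partial>lborel)" for a b
  define J where "J a b = jump_times n \<inter> {a<..b}" for a b
  define D where "D s = f s (Suc (left_limit n s)) - f s (left_limit n s)" for s
  \<comment> \<open>On \<open>(u, c]\<close> the left limit is the constant \<open>n u\<close>, so
    the drift part is a classical integral; a jump at \<open>c\<close> itself does not affect
    it.\<close>
  have piece: "I u c = ennreal (f c (n u) - f u (n u)) \<and> f u (n u) \<le> f c (n u) \<and> J u c \<subseteq> {c} \<and>
      left_limit n c = n u"
    if au: "a \<le> u" "u < c" "c \<le> b" and const: "\<And>v. u \<le> v \<Longrightarrow> v < c \<Longrightarrow> n v = n u" for u c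
  proof -
    have ll: "left_limit n s = n u" if "u < s" "s \<le> c" for s
      by (rule left_limit_eqI[OF assms(1) that(1)], rule const) (use that in linarith)+
    have "I u c = (\<integral>\<^sup>+s\<in>{u<..c}. ennreal (f' s (n u)) \<partial>lborel)"
      unfolding I_def by (intro nn_integral_cong) (auto simp: ll indicator_def)
    moreover have "(\<integral>\<^sup>+s\<in>{u<..c}. ennreal (f' s (n u)) \<partial>lborel) = ennreal (f c (n u) - f u (n u))
        \<and> f u (n u) \<le> f c (n u)"
    proof -
      have c: "continuous_on {u..c} (\<lambda>s. f' s (n u))"
        using au by (intro continuous_on_subset[OF cont[of "n u"]]) auto
      have p: "0 \<le> f' s (n u)" if "u < s" "s \<le> c" for s
        using nonneg[of s] ll[OF that] that au by auto
      have d: "((\<lambda>s. f s (n u)) has_real_derivative f' s (n u)) (at s)" if "u \<le> s" "s \<le> c" for s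
        using that au by (intro deriv) auto
      show ?thesis
        using nn_integral_FTC_Ioc[of u c "\<lambda>s. f s (n u)" "\<lambda>s. f' s (n u)", OF au(2) d c p] by simp
    qed
    moreover have "J u c \<subseteq> {c}"
    proof
      fix s assume s: "s \<in> J u c"
      show "s \<in> {c}"
      proof (rule ccontr)
        assume "s \<notin> {c}"
        hence "u < s" "s < c" using s by (auto simp: J_def)
        hence "n s = n u" "left_limit n s = n u" using const[of s] ll[of s] by simp_all
        thus False using s by (auto simp: J_def jump_times_def)
      qed
    qed
    ultimately show ?thesis using ll[of c] au by auto
  qed
  \<comment> \<open>Induction on the increase of \<open>n\<close> that remains up to
    \<open>b\<close>, splitting off the interval that ends with the next jump.\<close>
  have "finite (J u b) \<and> (\<exists>G\<ge>0. I u b = ennreal G \<and> f b (n b) - f u (n u) = G + sum D (J u b))"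
    if "a \<le> u" "u \<le> b" for u
    using that
  proof (induction "n b - n u" arbitrary: u rule: less_induct)
    case less
    show ?case
    proof (cases "u = b")
      case True
      thus ?thesis by (auto simp: J_def I_def)
    next
      case ub: False
      hence ub: "u < b" using less by simp
      show ?thesis
      proof (cases "n b = n u")
        case True
        have const: "n v = n u" if "u \<le> v" "v \<le> b" for v
          using True monoD[OF assms(1) that(1)] monoD[OF assms(1) that(2)] by simp
        have p: "I u b = ennreal (f b (n u) - f u (n u)) \<and> f u (n u) \<le> f b (n u) \<and> J u b \<subseteq> {b} \<and>
          left_limit n b = n u"
          by (rule piece, use less ub in linarith, use ub in linarith, simp) (rule const; linarith)
        hence "b \<notin> J u b" using True by (auto simp: J_def jump_times_def)
        hence "J u b = {}" using p by auto
        thus ?thesis using p True by (auto intro!: exI[of _ "f b (n u) - f u (n u)"])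
      next
        case False
        hence nb: "n u < n b" using monoD[OF assms(1), of u b] ub by simp
        \<comment> \<open>\<open>Inf S\<close> is the next jump time; right continuity shows that
          the new value is already taken there.\<close>
        define S where "S = {v. n u < n v}"
        have uS: "u \<le> v" if "v \<in> S" for v
          using that monoD[OF assms(1), of v u] unfolding S_def by force
        have SI: "S \<noteq> {}" "bdd_below S" using nb uS unfolding S_def
          by (auto intro!: bdd_belowI[of _ u])
        define c where "c = Inf S"
        have cb: "c \<le> b" unfolding c_def using nb SI by (intro cInf_lower) (auto simp: S_def)
        have lt: "n v \<le> n u" if "v < c" for v
          using that cInf_lower[OF _ SI(2), of v] unfolding c_def[symmetric] by (force simp: S_def)
        have ev: "eventually (\<lambda>w. n w = n v) (at_right v)" for v
          using rc[of v] unfolding continuous_within tendsto_discrete .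
        have gt: "n u < n w" if cw: "c < w" for w
        proof -
          obtain v where "v \<in> S" "v < w" using cw cInf_lessD[OF SI(1)] unfolding c_def by blast
          thus ?thesis using monoD[OF assms(1), of v w] by (auto simp: S_def)
        qed
        have nc: "n u < n c"
        proof -
          obtain w where "c < w" "n w = n c"
            using ev[of c] unfolding eventually_at_right_field
            by (meson dense)
          thus ?thesis using gt by metis
        qed
        have uc: "u < c"
        proof (rule ccontr)
          assume "\<not> u < c"
          thus False using monoD[OF assms(1), of c u] nc by simp
        qed
        have const: "n v = n u" if "u \<le> v" "v < c" for v
          using lt[OF that(2)] monoD[OF assms(1) that(1)] by simp
        have p: "I u c = ennreal (f c (n u) - f u (n u)) \<and> f u (n u) \<le> f c (n u) \<and> J u c \<subseteq> {c} \<and>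
          left_limit n c = n u"
          by (rule piece, use less in linarith, rule uc, rule cb) (rule const)
        have ncS: "n c = Suc (n u)" using jump[of c] nc p by auto
        \<comment> \<open>\<open>jump_times\<close> contains positive times only;
          \<open>0 \<le> a \<le> u < c\<close> ensures this for \<open>c\<close>.\<close>
        have J1: "J u c = {c}" using p nc uc less assms(4) by (auto simp: J_def jump_times_def)
        have "n b - n c < n b - n u" using nc nb by linarith
        from less(1)[OF this _ cb] uc less(2)
        obtain G where G: "finite (J c b)" "G \<ge> 0" "I c b = ennreal G"
          "f b (n b) - f c (n c) = G + sum D (J c b)" by auto
        have Jeq: "J u b = insert c (J c b)"
        proof -
          have "J u b = J u c \<union> J c b" using uc cb by (auto simp: J_def)
          thus ?thesis by (simp add: J1)
        qed
        have "I u b = I u c + I c b"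
        proof -
          \<comment> \<open>Measurability is required of one summand only, and on the first piece
            the left limit is constant.\<close>
          have m: "(\<lambda>s. ennreal (f' s (left_limit n s)) * indicator {u<..c} s) \<in> borel_measurable lborel"
          proof -
            have "(\<lambda>s. ennreal (f' s (left_limit n s)) * indicator {u<..c} s) =
                (\<lambda>s. ennreal (if s \<in> {u..c} then f' s (n u) else 0) * indicator {u<..c} s)"
            proof
              fix s
              have "left_limit n s = n u" if "u < s" "s \<le> c"
                by (rule left_limit_eqI[OF assms(1) that(1)], rule const) (use that in linarith)+
              thus "ennreal (f' s (left_limit n s)) * indicator {u<..c} s =
                ennreal (if s \<in> {u..c} then f' s (n u) else 0) * indicator {u<..c} s"
                by (cases "s \<in> {u<..c}") auto
            qed
            moreover have "(\<lambda>s. if s \<in> {u..c} then f' s (n u) else 0) \<in> borel_measurable borel"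
              using less(2) cb
              by (intro borel_measurable_continuous_on_if continuous_on_subset[OF cont[of "n u"]]) auto
            ultimately show ?thesis by simp
          qed
          have "I u b = (\<integral>\<^sup>+s. ennreal (f' s (left_limit n s)) * indicator {u<..c} s +
             ennreal (f' s (left_limit n s)) * indicator {c<..b} s \<partial>lborel)"
            unfolding I_def using uc cb by (intro nn_integral_cong) (auto simp: indicator_def)
          also have "\<dots> = I u c + I c b"
            unfolding I_def by (rule nn_integral_add_left_measurable[OF m])
          finally show ?thesis .
        qed
        hence Iub: "I u b = ennreal (f c (n u) - f u (n u) + G)" using p G by simp
        have "sum D (J u b) = D c + sum D (J c b)" unfolding Jeq
          using G(1) by (intro sum.insert) (auto simp: J_def)
        moreover have "D c = f c (n c) - f c (n u)" using p ncS by (simp add: D_def)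
        ultimately have "f b (n b) - f u (n u) = (f c (n u) - f u (n u) + G) + sum D (J u b)"
          using G(4) by simp
        moreover have "finite (J u b)" "0 \<le> f c (n u) - f u (n u) + G" using G p Jeq by simp_all
        ultimately show ?thesis using Iub by blast
      qed
    qed
  qed
  from this[of a] \<open>a \<le> b\<close> show "finite (jump_times n \<inter> {a<..b})"
    and "\<exists>G\<ge>0. (\<integral>\<^sup>+s\<in>{a<..b}. ennreal (f' s (left_limit n s)) \<partial>lborel) = ennreal G \<and>
       f b (n b) - f a (n a) = G + (\<Sum>s\<in>jump_times n \<inter> {a<..b}.
         f s (Suc (left_limit n s)) - f s (left_limit n s))"
    unfolding I_def J_def D_def by auto
qed

subsection \<open>Predictability and stopping\<close>

locale counting_process =
  fixes M :: "'a measure" and N :: "real \<Rightarrow> 'a \<Rightarrow> nat"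
  assumes spp: "simple_point_process M N"
begin

abbreviation "NF \<equiv> natural_filtration M N"
abbreviation "PM \<equiv> predictable_sigma M NF"
definition N_left :: "real \<Rightarrow> 'a \<Rightarrow> nat" where "N_left s \<omega> = left_limit (\<lambda>t. N t \<omega>) s"

lemma N_measurable [measurable]: "N t \<in> measurable M (count_space UNIV)"
  using spp by (simp add: simple_point_process_def)

lemma path:
  assumes "\<omega> \<in> space M"
  shows "mono (\<lambda>t. N t \<omega>)" "t \<le> 0 \<Longrightarrow> N t \<omega> = 0"
    "continuous (at_right t) (\<lambda>s. N s \<omega>)" "N t \<omega> \<le> left_limit (\<lambda>s. N s \<omega>) t + 1"
  using spp assms by (auto simp: simple_point_process_def)

lemma space_natural_filtration [simp]: "space (NF t) = space M"
  unfolding natural_filtration_def by (rule space_measure_of) auto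

lemma in_natural_filtration: "r \<le> t \<Longrightarrow> N r -` B \<inter> space M \<in> sets (NF t)"
  unfolding natural_filtration_def by (subst sets_measure_of) (auto intro!: sigma_sets.Basic)

lemma natural_filtration_subset: "sets (NF t) \<subseteq> sets M"
  unfolding natural_filtration_def
  by (subst sets_measure_of) (auto intro!: sets.sigma_sets_subset measurable_sets[OF N_measurable])

lemma predictable_generators_subset:
  "{{a<..b} \<times> A | a b A. 0 \<le> a \<and> a \<le> b \<and> A \<in> sets (NF a)} \<subseteq> Pow ({0<..} \<times> space M)"
  using natural_filtration_subset sets.sets_into_space by fastforce

lemma space_predictable [simp]: "space PM = {0<..} \<times> space M"
  unfolding predictable_sigma_def by (rule space_measure_of[OF predictable_generators_subset])

lemma predictable_rectangle:
  "0 \<le> a \<Longrightarrow> A \<in> sets (NF a) \<Longrightarrow> {a<..b} \<times> A \<in> sets PM"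
  unfolding predictable_sigma_def sets_measure_of[OF predictable_generators_subset]
  by (cases "a \<le> b") (auto intro!: sigma_sets.Basic sigma_sets.Empty)

lemma predictable_ray:
  assumes "0 \<le> a" "A \<in> sets (NF a)"
  shows "{a<..} \<times> A \<in> sets PM"
proof -
  have "{a<..} \<times> A = (\<Union>n::nat. {a<..a + real n} \<times> A)"
  proof safe
    fix x y assume "a < x" "y \<in> A"
    moreover obtain n :: nat where "x - a \<le> real n" using real_arch_simple by blast
    ultimately show "(x, y) \<in> (\<Union>n::nat. {a<..a + real n} \<times> A)"
      by (intro UN_I[of n]) auto
  qed auto
  also have "\<dots> \<in> sets PM" using assms by (intro sets.countable_UN) (auto intro: predictable_rectangle)
  finally show ?thesis .
qed

lemma fst_predictable: "fst \<in> borel_measurable PM"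
proof (subst borel_measurable_iff_greater, intro allI)
  fix c :: real
  have "{w \<in> space PM. c < fst w} = {max c 0<..} \<times> space M" by auto
  also have "\<dots> \<in> sets PM"
    using sets.top[of "NF (max c 0)"] by (intro predictable_ray) simp_all
  finally show "{w \<in> space PM. c < fst w} \<in> sets PM" .
qed

text \<open>The left limit at \<open>s\<close> is at least \<open>k\<close> iff \<open>N r\<close>
  has reached \<open>k\<close> at some rational \<open>r < s\<close>; each such \<open>r\<close>
  contributes a ray over an event of \<open>NF r\<close>.\<close>

lemma N_left_predictable: "(\<lambda>x. N_left (fst x) (snd x)) \<in> measurable PM (count_space UNIV)"
proof -
  let ?g = "\<lambda>x. N_left (fst x) (snd x)"
  have ge: "{x \<in> space PM. k \<le> ?g x} \<in> sets PM" for k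
  proof -
    have "{x \<in> space PM. k \<le> ?g x} = (\<Union>r\<in>{r \<in> \<rat>. 0 \<le> r}. {r<..} \<times> (N r -` {k..} \<inter> space M))"
      using left_limit_ge_iff[OF path(1)] by (fastforce simp: N_left_def)
    also have "\<dots> \<in> sets PM"
      by (intro sets.countable_UN'' predictable_ray in_natural_filtration)
         (auto intro: countable_subset[OF _ countable_rat])
    finally show ?thesis .
  qed
  have "?g -` {k} \<inter> space PM \<in> sets PM" for k
  proof -
    have "?g -` {k} \<inter> space PM = {x \<in> space PM. k \<le> ?g x} - {x \<in> space PM. Suc k \<le> ?g x}" by auto
    thus ?thesis using sets.Diff[OF ge ge, of k "Suc k"] by simp
  qed
  thus ?thesis by (subst measurable_count_space_eq2_countable) auto
qed

text \<open>Only rational times are tested, to keep measurability countable.\<close>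

definition stay :: "(real \<Rightarrow> nat set) \<Rightarrow> real \<Rightarrow> real \<Rightarrow> 'a \<Rightarrow> bool" where
  "stay K T s \<omega> \<longleftrightarrow> (\<forall>r\<in>\<rat>. T \<le> r \<longrightarrow> r < s \<longrightarrow> N r \<omega> \<in> K r)"

text \<open>The constraint at \<open>r\<close> restricts later times only, so it is a ray over an
  event of \<open>NF r\<close> together with all times up to \<open>r\<close>.\<close>

lemma stay_predictable:
  assumes "0 \<le> T"
  shows "{x \<in> space PM. stay K T (fst x) (snd x)} \<in> sets PM"
proof -
  have m: "{x \<in> space PM. r < fst x \<longrightarrow> N r (snd x) \<in> K r} \<in> sets PM" if "T \<le> r" for r
  proof -
    have "{x \<in> space PM. r < fst x \<longrightarrow> N r (snd x) \<in> K r} =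
        {0<..r} \<times> space M \<union> {r<..} \<times> (N r -` K r \<inter> space M)"
      using assms that by auto
    also have "\<dots> \<in> sets PM"
      using assms that sets.top[of "NF 0"]
      by (intro sets.Un predictable_rectangle predictable_ray in_natural_filtration) auto
    finally show ?thesis .
  qed
  have "{x \<in> space PM. stay K T (fst x) (snd x)} =
      space PM \<inter> (\<Inter>r\<in>{r\<in>\<rat>. T \<le> r}. {x \<in> space PM. r < fst x \<longrightarrow> N r (snd x) \<in> K r})"
    by (auto simp: stay_def)
  also have "\<dots> \<in> sets PM"
  proof (intro sets.Int sets.top sets.countable_INT')
    show "countable {r \<in> \<rat>. T \<le> r}" by (auto intro: countable_subset[OF _ countable_rat])
    have "of_int \<lceil>T\<rceil> \<in> {r \<in> \<rat>. T \<le> r}" by auto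
    thus "{r \<in> \<rat>. T \<le> r} \<noteq> {}" by blast
  qed (use m in auto)
  finally show ?thesis .
qed

text \<open>Predictable rectangles are product-measurable, so \<open>PM\<close> is coarser than the
  trace of the product sigma-algebra on positive times. The indicator extends \<open>g\<close> by
  zero, which makes Tonelli's theorem available.\<close>

lemma predictable_imp_product_measurable:
  fixes g :: "real \<times> 'a \<Rightarrow> ennreal"
  assumes "g \<in> borel_measurable PM"
  shows "(\<lambda>x. g x * indicator ({0<..} \<times> space M) x) \<in> borel_measurable (lborel \<Otimes>\<^sub>M M)"
proof -
  let ?R = "restrict_space (lborel \<Otimes>\<^sub>M M) ({0::real<..} \<times> space M)"
  have *: "({0::real<..} \<times> space M) \<inter> space (lborel \<Otimes>\<^sub>M M) \<in> sets (lborel \<Otimes>\<^sub>M M)"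
    by (intro sets.Int sets.top pair_measureI) (simp_all add: borel_open)
  have spR: "space ?R = {0::real<..} \<times> space M" by (auto simp: space_restrict_space space_pair_measure)
  have "sets PM \<subseteq> sets ?R"
  proof -
    have "X \<in> sets ?R" if Xg: "X \<in> {{a<..b} \<times> A | a b A. 0 \<le> a \<and> a \<le> b \<and> A \<in> sets (NF a)}" for X
    proof -
      obtain a b A where X: "X = {a<..b} \<times> A" "0 \<le> a" "A \<in> sets (NF a)" using Xg by auto
      have "X \<in> sets (lborel \<Otimes>\<^sub>M M)" unfolding X
        using X natural_filtration_subset by (intro pair_measureI) auto
      moreover have "X \<subseteq> {0<..} \<times> space M" using predictable_generators_subset Xg by auto
      ultimately show ?thesis using * by (subst sets_restrict_space_iff) (auto simp: Int_absorb2)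
    qed
    hence "sigma_sets (space ?R) {{a<..b} \<times> A | a b A. 0 \<le> a \<and> a \<le> b \<and> A \<in> sets (NF a)} \<subseteq> sets ?R"
      by (intro sets.sigma_sets_subset) auto
    thus ?thesis
      unfolding spR predictable_sigma_def sets_measure_of[OF predictable_generators_subset] .
  qed
  hence "g \<in> borel_measurable ?R" using assms spR
    by (auto simp: measurable_def)
  thus ?thesis using borel_measurable_restrict_space_iff_ennreal[OF *] by blast
qed


text \<open>Indicator of the random interval from \<open>T\<close> to the smaller of
  \<open>t\<close> and the exit time from \<open>K\<close>, without naming the exit time; extended
  nonnegative so that it can weight integrands.\<close>

definition stopped :: "(real \<Rightarrow> nat set) \<Rightarrow> real \<Rightarrow> real \<Rightarrow> real \<Rightarrow> 'a \<Rightarrow> ennreal" where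
  "stopped K T t s \<omega> = (if T < s \<and> s \<le> t \<and> stay K T s \<omega> then 1 else 0)"

text \<open>Just before \<open>s\<close> the path equals its left limit, so this value lies in
  \<open>K q\<close> for rational \<open>q\<close> arbitrarily close to \<open>s\<close>. Closedness
  carries this over to \<open>s\<close>, which \<open>stay\<close> itself does not test.\<close>

lemma N_left_in_region:
  assumes \<omega>: "\<omega> \<in> space M" and cl: "\<And>k. closed {s \<in> {T..}. k \<in> K s}"
    and "T < s" "stay K T s \<omega>"
  shows "N_left s \<omega> \<in> K s"
proof -
  obtain r where r: "r < s" "\<And>u. r \<le> u \<Longrightarrow> u < s \<Longrightarrow> N u \<omega> = N_left s \<omega>"
    using left_limit_mono_nat[OF path(1)[OF \<omega>], of s] unfolding N_left_def by blast
  have "s \<in> {u \<in> {T..}. N_left s \<omega> \<in> K u}"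
  proof (rule closed_approachable[OF cl, THEN iffD1], intro allI impI)
    fix e :: real assume "0 < e"
    hence "max (max r T) (s - e) < s" using r assms by auto
    from Rats_dense_in_real[OF this] obtain q where q: "q \<in> \<rat>" "max (max r T) (s - e) < q" "q < s"
      by blast
    hence "N q \<omega> \<in> K q" using assms(4) by (auto simp: stay_def)
    moreover have "N q \<omega> = N_left s \<omega>" using q by (intro r(2)) auto
    ultimately show "\<exists>y\<in>{u \<in> {T..}. N_left s \<omega> \<in> K u}. dist y s < e"
      using q by (intro bexI[of _ q]) (auto simp: dist_real_def)
  qed
  thus ?thesis by auto
qed

text \<open>\<open>stay\<close> at \<open>s\<close> tests times strictly before \<open>s\<close>, so
  it passes to smaller \<open>s\<close> and to the supremum.\<close>

lemma stopped_interval: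
  assumes "T < t"
  shows "{s. T < s \<and> s \<le> t \<and> stay K T s \<omega>} = {} \<or>
    (\<exists>\<tau>. T < \<tau> \<and> \<tau> \<le> t \<and> {s. T < s \<and> s \<le> t \<and> stay K T s \<omega>} = {T<..\<tau>})"
proof -
  define S where "S = {s. T < s \<and> s \<le> t \<and> stay K T s \<omega>}"
  show ?thesis
  proof (cases "S = {}")
    case False
    have bdd: "bdd_above S" unfolding S_def by (rule bdd_aboveI[of _ t]) auto
    obtain s where s: "s \<in> S" using False by auto
    have up: "s \<le> Sup S" if "s \<in> S" for s using cSup_upper[OF that bdd] .
    have le: "Sup S \<le> t" using False by (intro cSup_least) (auto simp: S_def)
    have st: "stay K T (Sup S) \<omega>"
      unfolding stay_def
    proof (intro ballI impI)
      fix r assume r: "r \<in> \<rat>" "T \<le> r" "r < Sup S"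
      then obtain s where "s \<in> S" "r < s" using less_cSupD[OF False] by auto
      thus "N r \<omega> \<in> K r" using r by (auto simp: S_def stay_def)
    qed
    have "S = {T<..Sup S}"
      using up st le by (auto simp: S_def stay_def)
    moreover have "T < Sup S" using up[OF s] s by (auto simp: S_def)
    ultimately show ?thesis using le unfolding S_def by metis
  qed (simp add: S_def)
qed

text \<open>Until the stopping time \<open>f\<close> rises by at most \<open>C + K0\<close>.
  Shifting the time derivative by \<open>\<kappa>\<close> and putting positive and negative parts of
  the jumps on opposite sides turns this into an inequality between extended nonnegative
  terms.\<close>

lemma stopped_path_inequality:
  fixes f f' :: "real \<Rightarrow> nat \<Rightarrow> real"
  assumes \<omega>: "\<omega> \<in> space M" and T: "0 \<le> T" "T \<in> \<rat>" "T < t"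
    and cl: "\<And>k. closed {s \<in> {T..}. k \<in> K s}"
    and deriv: "\<And>k s. 0 \<le> s \<Longrightarrow> ((\<lambda>s. f s k) has_real_derivative f' s k) (at s)"
    and cont: "\<And>k. continuous_on {0..} (\<lambda>s. f' s k)"
    and upper: "\<And>s k. T \<le> s \<Longrightarrow> k \<in> K s \<Longrightarrow> f s k \<le> C \<and> f s (Suc k) \<le> C"
    and lower: "\<And>k. k \<in> K T \<Longrightarrow> - K0 \<le> f T k"
    and \<kappa>: "\<And>s k. T \<le> s \<Longrightarrow> s \<le> t \<Longrightarrow> k \<in> K s \<Longrightarrow> - \<kappa> \<le> f' s k" "0 \<le> \<kappa>"
  defines "D \<equiv> \<lambda>s. f s (Suc (N_left s \<omega>)) - f s (N_left s \<omega>)"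
  defines "J \<equiv> jump_times (\<lambda>t. N t \<omega>)"
  shows "(\<integral>\<^sup>+s\<in>{0<..}. ennreal (f' s (N_left s \<omega>) + \<kappa>) * stopped K T t s \<omega> \<partial>lborel) +
      (\<integral>\<^sup>+s. ennreal (D s) * stopped K T t s \<omega> \<partial>count_space J)
    \<le> ((\<integral>\<^sup>+s\<in>{0<..}. ennreal \<kappa> * stopped K T t s \<omega> \<partial>lborel) + ennreal (C + K0)) +
      (\<integral>\<^sup>+s. ennreal (- D s) * stopped K T t s \<omega> \<partial>count_space J)"
proof (cases "{s. T < s \<and> s \<le> t \<and> stay K T s \<omega>} = {}")
  case True
  hence "stopped K T t s \<omega> = 0" for s by (auto simp: stopped_def)
  thus ?thesis by simp
next
  case False
  then obtain \<tau> where \<tau>: "T < \<tau>" "\<tau> \<le> t" "{s. T < s \<and> s \<le> t \<and> stay K T s \<omega>} = {T<..\<tau>}"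
    using stopped_interval[OF T(3), of K \<omega>] by auto
  have st: "stopped K T t s \<omega> = indicator {T<..\<tau>} s" for s
    using \<tau>(3) by (auto simp: stopped_def indicator_def set_eq_iff)
  have stay: "stay K T \<tau> \<omega>" using \<tau> by (auto simp: set_eq_iff)
  have inK: "N_left s \<omega> \<in> K s" if "T < s" "s \<le> \<tau>" for s
    using that \<tau> by (intro N_left_in_region[OF \<omega> cl]) (auto simp: set_eq_iff)
  \<comment> \<open>As \<open>T\<close> is rational, \<open>stay\<close> tests the time
    \<open>T\<close> itself.\<close>
  have NT: "N T \<omega> \<in> K T" using stay T \<tau> by (auto simp: stay_def)
  \<comment> \<open>Adding \<open>\<kappa> * s\<close> makes the time derivative nonnegative in the
    region, as \<open>counting_path_change\<close> demands.\<close>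
  define h where "h s k = f s k + \<kappa> * s" for s k
  define h' where "h' s k = f' s k + \<kappa>" for s k
  have change: "finite (J \<inter> {T<..\<tau>})"
    "\<exists>G\<ge>0. (\<integral>\<^sup>+s\<in>{T<..\<tau>}. ennreal (h' s (N_left s \<omega>)) \<partial>lborel) = ennreal G \<and>
       h \<tau> (N \<tau> \<omega>) - h T (N T \<omega>) = G + (\<Sum>s\<in>J \<inter> {T<..\<tau>}. h s (Suc (N_left s \<omega>)) - h s (N_left s \<omega>))"
  proof -
    have d: "((\<lambda>s. h s k) has_real_derivative h' s k) (at s)" if "T \<le> s" "s \<le> \<tau>" for k s
      unfolding h_def h'_def using T that by (auto intro!: derivative_eq_intros deriv)
    have c: "continuous_on {T..\<tau>} (\<lambda>s. h' s k)" for k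
      unfolding h'_def using T
      by (intro continuous_intros continuous_on_subset[OF cont]) auto
    have nn: "0 \<le> h' s (left_limit (\<lambda>t. N t \<omega>) s)" if "T < s" "s \<le> \<tau>" for s
      using \<kappa>(1)[of s "N_left s \<omega>"] inK[OF that] that \<tau> by (auto simp: h'_def N_left_def)
    note * = counting_path_change[where n = "\<lambda>t. N t \<omega>" and f = h and f' = h' and a = T and b = \<tau>,
        OF path(1)[OF \<omega>] path(3)[OF \<omega>] path(4)[OF \<omega>] T(1) less_imp_le[OF \<tau>(1)] d c nn]
    show "finite (J \<inter> {T<..\<tau>})" using *(1) by (simp add: J_def)
    show "\<exists>G\<ge>0. (\<integral>\<^sup>+s\<in>{T<..\<tau>}. ennreal (h' s (N_left s \<omega>)) \<partial>lborel) = ennreal G \<and>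
       h \<tau> (N \<tau> \<omega>) - h T (N T \<omega>) = G + (\<Sum>s\<in>J \<inter> {T<..\<tau>}. h s (Suc (N_left s \<omega>)) - h s (N_left s \<omega>))"
      using *(2) by (simp add: J_def N_left_def)
  qed
  then obtain G where G: "G \<ge> 0" "(\<integral>\<^sup>+s\<in>{T<..\<tau>}. ennreal (h' s (N_left s \<omega>)) \<partial>lborel) = ennreal G"
    "h \<tau> (N \<tau> \<omega>) - h T (N T \<omega>) = G + (\<Sum>s\<in>J \<inter> {T<..\<tau>}. h s (Suc (N_left s \<omega>)) - h s (N_left s \<omega>))"
    by blast
  define A where "A = J \<inter> {T<..\<tau>}"
  have finA: "finite A" using change(1) by (simp add: A_def)
  \<comment> \<open>\<open>ennreal\<close> sends negative numbers to zero, so this extracts positive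
    parts; the stopped sum has finitely many terms.\<close>
  have jumps: "(\<integral>\<^sup>+s. ennreal (g s) * stopped K T t s \<omega> \<partial>count_space J) = ennreal (\<Sum>s\<in>A. max 0 (g s))"
    for g :: "real \<Rightarrow> real"
  proof -
    have "(\<integral>\<^sup>+s. ennreal (g s) * stopped K T t s \<omega> \<partial>count_space J) =
        (\<Sum>s\<in>A. ennreal (g s) * stopped K T t s \<omega>)"
      using finA by (intro nn_integral_count_space') (auto simp: A_def st)
    also have "\<dots> = (\<Sum>s\<in>A. ennreal (max 0 (g s)))"
      by (intro sum.cong) (auto simp: A_def st max_def ennreal_neg)
    also have "\<dots> = ennreal (\<Sum>s\<in>A. max 0 (g s))" by (rule sum_ennreal) simp
    finally show ?thesis .
  qed
  have I1: "(\<integral>\<^sup>+s\<in>{0<..}. ennreal (f' s (N_left s \<omega>) + \<kappa>) * stopped K T t s \<omega> \<partial>lborel) = ennreal G"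
    unfolding G(2)[symmetric] using T
    by (intro nn_integral_cong) (auto simp: st h'_def indicator_def)
  have "(\<integral>\<^sup>+s\<in>{0<..}. ennreal \<kappa> * stopped K T t s \<omega> \<partial>lborel) =
      (\<integral>\<^sup>+s. ennreal \<kappa> * indicator {T<..\<tau>} s \<partial>lborel)"
    using T by (intro nn_integral_cong) (auto simp: st indicator_def)
  also have "\<dots> = ennreal (\<kappa> * (\<tau> - T))"
    using \<tau>(1) \<kappa>(2) by (subst nn_integral_cmult_indicator) (auto simp: ennreal_mult)
  finally have I2: "(\<integral>\<^sup>+s\<in>{0<..}. ennreal \<kappa> * stopped K T t s \<omega> \<partial>lborel) = ennreal (\<kappa> * (\<tau> - T))" .
  \<comment> \<open>A jump at \<open>\<tau>\<close> may lead out of \<open>K\<close>; for this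
    reason \<open>upper\<close> also bounds the successor state.\<close>
  have "N \<tau> \<omega> = N_left \<tau> \<omega> \<or> N \<tau> \<omega> = Suc (N_left \<tau> \<omega>)"
    using path(4)[OF \<omega>, of \<tau>] left_limit_le[OF path(1)[OF \<omega>], of \<tau>] by (auto simp: N_left_def)
  hence up: "f \<tau> (N \<tau> \<omega>) \<le> C"
    using upper[OF less_imp_le[OF \<tau>(1)] inK[OF \<tau>(1) order_refl]] by auto
  have "f \<tau> (N \<tau> \<omega>) + \<kappa> * \<tau> - (f T (N T \<omega>) + \<kappa> * T) = G + (\<Sum>s\<in>A. D s)"
    using G(3) by (simp add: h_def A_def D_def)
  moreover have "(\<Sum>s\<in>A. D s) = (\<Sum>s\<in>A. max 0 (D s)) - (\<Sum>s\<in>A. max 0 (- D s))"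
    unfolding sum_subtractf[symmetric] by (intro sum.cong) auto
  ultimately have main: "G + (\<Sum>s\<in>A. max 0 (D s)) \<le> \<kappa> * (\<tau> - T) + (C + K0) + (\<Sum>s\<in>A. max 0 (- D s))"
    using up lower[OF NT] by (simp add: algebra_simps)
  \<comment> \<open>The path starts in \<open>K T\<close>, where
    \<open>- K0 \<le> f T \<le> C\<close>; hence \<open>ennreal (C + K0)\<close> does not
    truncate.\<close>
  have "0 \<le> C + K0" using lower[OF NT] upper[OF order_refl NT] by linarith
  moreover have "0 \<le> (\<Sum>s\<in>A. max 0 (D s))" "0 \<le> (\<Sum>s\<in>A. max 0 (- D s))" "0 \<le> \<kappa> * (\<tau> - T)"
    using \<kappa>(2) \<tau>(1) by (auto intro!: sum_nonneg)
  ultimately show ?thesis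
    unfolding I1 I2 jumps using main G(1)
    by (simp add: ennreal_plus[symmetric] del: ennreal_plus)
qed

section \<open>Integrals of predictable processes over positive times\<close>

lemma predictable_section_measurable:
  fixes g :: "real \<times> 'a \<Rightarrow> ennreal"
  assumes "g \<in> borel_measurable PM" "\<omega> \<in> space M"
  shows "(\<lambda>s. g (s, \<omega>) * indicator {0<..} s) \<in> borel_measurable borel"
proof -
  have "(\<lambda>s. g (s, \<omega>) * indicator ({0<..} \<times> space M) (s, \<omega>)) \<in> borel_measurable lborel"
    using measurable_compose[OF measurable_Pair2'[OF assms(2)] predictable_imp_product_measurable[OF assms(1)]]
    by simp
  thus ?thesis using assms(2) by (simp add: indicator_times)
qed

lemma predictable_integral_measurable:
  fixes g :: "real \<times> 'a \<Rightarrow> ennreal"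
  assumes "g \<in> borel_measurable PM"
  shows "(\<lambda>\<omega>. \<integral>\<^sup>+s\<in>{0<..}. g (s, \<omega>) \<partial>lborel) \<in> borel_measurable M"
proof -
  have "(\<lambda>(\<omega>, s). g (s, \<omega>) * indicator ({0<..} \<times> space M) (s, \<omega>)) \<in> borel_measurable (M \<Otimes>\<^sub>M lborel)"
    using measurable_pair_swap[OF predictable_imp_product_measurable[OF assms]] by simp
  from lborel.borel_measurable_nn_integral[OF this]
  have "(\<lambda>\<omega>. \<integral>\<^sup>+s. g (s, \<omega>) * indicator ({0<..} \<times> space M) (s, \<omega>) \<partial>lborel) \<in> borel_measurable M" .
  thus ?thesis by (subst measurable_cong[where g="\<lambda>\<omega>. \<integral>\<^sup>+s. g (s, \<omega>) * indicator ({0<..} \<times> space M) (s, \<omega>) \<partial>lborel"])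
     (auto simp: indicator_times)
qed

definition pred_integral :: "(real \<times> 'a \<Rightarrow> ennreal) \<Rightarrow> ennreal" where
  "pred_integral g = (\<integral>\<^sup>+\<omega>. (\<integral>\<^sup>+s\<in>{0<..}. g (s, \<omega>) \<partial>lborel) \<partial>M)"

lemma pred_integral_add:
  assumes "g \<in> borel_measurable PM" "h \<in> borel_measurable PM"
  shows "pred_integral (\<lambda>x. g x + h x) = pred_integral g + pred_integral h"
proof -
  have "pred_integral (\<lambda>x. g x + h x) = (\<integral>\<^sup>+\<omega>. (\<integral>\<^sup>+s\<in>{0<..}. g (s, \<omega>) \<partial>lborel) +
      (\<integral>\<^sup>+s\<in>{0<..}. h (s, \<omega>) \<partial>lborel) \<partial>M)"
    unfolding pred_integral_def
    by (intro nn_integral_cong, subst nn_integral_add[symmetric])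
       (auto simp: distrib_right predictable_section_measurable assms)
  also have "\<dots> = pred_integral g + pred_integral h"
    unfolding pred_integral_def by (intro nn_integral_add predictable_integral_measurable assms)
  finally show ?thesis .
qed

lemma pred_integral_mono:
  assumes "\<And>s \<omega>. 0 < s \<Longrightarrow> \<omega> \<in> space M \<Longrightarrow> g (s, \<omega>) \<le> h (s, \<omega>)"
  shows "pred_integral g \<le> pred_integral h"
  unfolding pred_integral_def
  using assms by (intro nn_integral_mono) (auto simp: indicator_def)

lemma stopped_predictable:
  assumes "0 \<le> T"
  shows "(\<lambda>x. stopped K T t (fst x) (snd x)) \<in> borel_measurable PM"
proof -
  have [measurable]: "Measurable.pred PM (\<lambda>x. stay K T (fst x) (snd x))"
    using stay_predictable[OF assms, of K] by (simp add: pred_def)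
  note [measurable] = fst_predictable
  show ?thesis unfolding stopped_def by measurable
qed

text \<open>\<open>N_left\<close> has countably many values, so measurability in time for each fixed
  state is enough. Continuity is given for nonnegative times only, so \<open>h\<close> is first
  replaced by zero elsewhere.\<close>

lemma function_of_N_left_predictable:
  fixes h :: "real \<Rightarrow> nat \<Rightarrow> real"
  assumes "\<And>k. continuous_on {0..} (\<lambda>s. h s k)"
  shows "(\<lambda>x. h (fst x) (N_left (fst x) (snd x))) \<in> borel_measurable PM"
proof -
  have "(\<lambda>s. if s \<in> {0..} then h s k else 0) \<in> borel_measurable borel" for k
    by (intro borel_measurable_continuous_on_if assms) auto
  hence "(\<lambda>x. if fst x \<in> {0..} then h (fst x) k else 0) \<in> borel_measurable PM" for k
    by (rule measurable_compose[OF fst_predictable])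
  from measurable_compose_countable[where f = "\<lambda>k x. if fst x \<in> {0..} then h (fst x) k else 0",
      OF this N_left_predictable]
  have "(\<lambda>x. if fst x \<in> {0..} then h (fst x) (N_left (fst x) (snd x)) else 0) \<in> borel_measurable PM" .
  moreover have "(\<lambda>x. h (fst x) (N_left (fst x) (snd x))) \<in> borel_measurable PM \<longleftrightarrow>
      (\<lambda>x. if fst x \<in> {0..} then h (fst x) (N_left (fst x) (snd x)) else 0) \<in> borel_measurable PM"
    by (rule measurable_cong) auto
  ultimately show ?thesis by blast
qed

end

subsection \<open>Exit from a neighbourhood of the fixed point\<close>

lemma continuous_family_bounded:
  fixes h :: "real \<Rightarrow> nat \<Rightarrow> real"
  assumes "\<And>k. continuous_on {a..b} (\<lambda>s. h s k)"
  obtains B where "0 \<le> B" "\<And>k s. k \<le> m \<Longrightarrow> a \<le> s \<Longrightarrow> s \<le> b \<Longrightarrow> \<bar>h s k\<bar> \<le> B"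
proof -
  have "compact (\<Union>k\<in>{..m}. (\<lambda>s. h s k) ` {a..b})"
    by (intro compact_UN compact_continuous_image assms) auto
  then obtain B where B: "\<forall>x\<in>(\<Union>k\<in>{..m}. (\<lambda>s. h s k) ` {a..b}). norm x \<le> B"
    using compact_imp_bounded bounded_iff by blast
  show ?thesis
  proof (rule that[of "max B 0"])
    fix k s assume "k \<le> m" "a \<le> s" "s \<le> b"
    hence "h s k \<in> (\<Union>k\<in>{..m}. (\<lambda>s. h s k) ` {a..b})" by (intro UN_I[of k] imageI) auto
    from B[rule_format, OF this] show "\<bar>h s k\<bar> \<le> max B 0" by simp
  qed simp
qed

locale self_exciting = counting_process M N + prob_space M
  for M :: "'a measure" and N :: "real \<Rightarrow> 'a \<Rightarrow> nat" +
  fixes lam :: "real \<Rightarrow> real" and \<gamma> :: real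
  assumes intensity: "has_intensity M (natural_filtration M N) N
      (\<lambda>t \<omega>. lam ((real (left_limit (\<lambda>s. N s \<omega>) t) + \<gamma>) / (t + 1)))"
    and lam_nonneg: "\<And>x. 0 \<le> x \<Longrightarrow> 0 \<le> lam x"
    and lam_cont: "continuous_on {0..} lam"
    and \<gamma>_nonneg: "0 \<le> \<gamma>"
begin

definition rate :: "real \<Rightarrow> nat \<Rightarrow> real" where "rate s k = lam ((real k + \<gamma>) / (s + 1))"

lemma rate_nonneg: "0 \<le> s \<Longrightarrow> 0 \<le> rate s k"
  unfolding rate_def using \<gamma>_nonneg by (intro lam_nonneg) auto

lemma rate_cont: "continuous_on {0..} (\<lambda>s. rate s k)"
  unfolding rate_def using \<gamma>_nonneg
  by (intro continuous_on_compose2[OF lam_cont]) (auto intro!: continuous_intros)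

lemma compensator:
  assumes "g \<in> borel_measurable PM"
  shows "(\<integral>\<^sup>+\<omega>. (\<integral>\<^sup>+s. g (s, \<omega>) \<partial>count_space (jump_times (\<lambda>t. N t \<omega>))) \<partial>M) =
    pred_integral (\<lambda>x. g x * ennreal (rate (fst x) (N_left (fst x) (snd x))))"
proof -
  have "(\<lambda>(s, \<omega>). g (s, \<omega>)) \<in> borel_measurable PM" using assms by simp
  with intensity show ?thesis
    unfolding has_intensity_def pred_integral_def rate_def N_left_def by auto
qed

definition region :: "real \<Rightarrow> real \<Rightarrow> real \<Rightarrow> nat set" where
  "region x \<epsilon> s = {k. \<bar>(real k + \<gamma>) / (s + 1) - x\<bar> \<le> \<epsilon>}"

lemma closed_region:
  assumes "0 \<le> T"
  shows "closed {s \<in> {T..}. k \<in> region x \<epsilon> s}"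
proof -
  have "closed ({T..} \<inter> (\<lambda>s. \<bar>(real k + \<gamma>) / (s + 1) - x\<bar>) -` {..\<epsilon>})"
    using assms by (intro continuous_closed_preimage continuous_intros) auto
  thus ?thesis by (simp add: region_def vimage_def Int_def)
qed

text \<open>Up to a fixed time only finitely many states lie in the region, so bounds uniform in the
  state exist.\<close>

lemma region_le:
  assumes "0 \<le> s" "s \<le> t" "k \<in> region x \<epsilon> s"
  shows "k \<le> nat \<lceil>(x + \<epsilon>) * (t + 1)\<rceil>"
proof -
  have X: "0 \<le> (real k + \<gamma>) / (s + 1)" "(real k + \<gamma>) / (s + 1) \<le> x + \<epsilon>"
    using assms \<gamma>_nonneg by (auto simp: region_def)
  have "real k \<le> (real k + \<gamma>) / (s + 1) * (s + 1)" using assms \<gamma>_nonneg by simp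
  also have "\<dots> \<le> (x + \<epsilon>) * (t + 1)" using X assms by (intro mult_mono) auto
  finally show ?thesis by linarith
qed

text \<open>A lower bound on \<open>f\<close> is required only at time \<open>T\<close>, where the
  region has finitely many states. The upper bound \<open>C\<close> is uniform in time, so the
  logarithm can outgrow it.\<close>

theorem stay_null:
  fixes f f' :: "real \<Rightarrow> nat \<Rightarrow> real"
  assumes T: "0 \<le> T" "T \<in> \<rat>"
    and deriv: "\<And>k s. 0 \<le> s \<Longrightarrow> ((\<lambda>s. f s k) has_real_derivative f' s k) (at s)"
    and cont: "\<And>k. continuous_on {0..} (\<lambda>s. f' s k)"
    and upper: "\<And>s k. T \<le> s \<Longrightarrow> k \<in> region x \<epsilon> s \<Longrightarrow> f s k \<le> C \<and> f s (Suc k) \<le> C"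
    and drift: "\<And>s k. T \<le> s \<Longrightarrow> k \<in> region x \<epsilon> s \<Longrightarrow>
      \<delta> / (s + 1) \<le> f' s k + rate s k * (f s (Suc k) - f s k)"
    and \<delta>: "0 < \<delta>"
  shows "AE \<omega> in M. \<not> (\<forall>r\<in>\<rat>. T \<le> r \<longrightarrow> N r \<omega> \<in> region x \<epsilon> r)"
proof -
  let ?K = "region x \<epsilon>"
  define A where "A = {\<omega> \<in> space M. \<forall>r\<in>{r \<in> \<rat>. T \<le> r}. N r \<omega> \<in> ?K r}"
  have cr: "countable {r \<in> \<rat>. T \<le> r}" by (auto intro: countable_subset[OF _ countable_rat])
  have A [measurable]: "A \<in> sets M"
  proof -
    have "A = space M \<inter> (\<Inter>r\<in>{r \<in> \<rat>. T \<le> r}. N r -` ?K r \<inter> space M)" by (auto simp: A_def)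
    also have "\<dots> \<in> sets M"
      using T cr by (intro sets.Int sets.top sets.countable_INT') (auto intro: measurable_sets)
    finally show ?thesis .
  qed
  have f_cont: "continuous_on {0..} (\<lambda>s. f s k)" for k
    using deriv by (intro continuous_at_imp_continuous_on) (auto intro: DERIV_isCont)
  obtain K0 where K0: "0 \<le> K0" "\<And>k s. k \<le> nat \<lceil>(x + \<epsilon>) * (T + 1)\<rceil> \<Longrightarrow> T \<le> s \<Longrightarrow> s \<le> T \<Longrightarrow> \<bar>f s k\<bar> \<le> K0"
    using continuous_family_bounded[of T T f] T by (metis continuous_on_sing atLeastAtMost_singleton)
  have lower: "- K0 \<le> f T k" if "k \<in> ?K T" for k
    using K0(2)[OF region_le[OF T(1) order_refl that]] by simp
  have main: "emeasure M A * ennreal (\<delta> * ln ((t + 1) / (T + 1))) \<le> ennreal (C + K0)" if t: "T < t" for t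
  proof -
    define m where "m = nat \<lceil>(x + \<epsilon>) * (t + 1)\<rceil>"
    have m: "k \<le> m" if "T \<le> s" "s \<le> t" "k \<in> ?K s" for s k
      unfolding m_def using T that by (intro region_le[of s]) auto
    have sub: "{T..t} \<subseteq> {0..}" using T by auto
    \<comment> \<open>\<open>\<kappa>\<close> here and \<open>\<beta>\<close> below may depend on
      \<open>t\<close>: they keep the integrals nonnegative and finite and drop out of the
      estimate.\<close>
    obtain \<kappa> where \<kappa>: "0 \<le> \<kappa>" "\<And>k s. k \<le> m \<Longrightarrow> T \<le> s \<Longrightarrow> s \<le> t \<Longrightarrow> \<bar>f' s k\<bar> \<le> \<kappa>"
      using continuous_family_bounded[of T t f' m] continuous_on_subset[OF cont sub] by metis
    define D where "D s k = f s (Suc k) - f s k" for s k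
    have D_cont: "continuous_on {0..} (\<lambda>s. D s k)" for k
      unfolding D_def by (intro continuous_intros f_cont)
    obtain \<beta> where \<beta>: "0 \<le> \<beta>" "\<And>k s. k \<le> m \<Longrightarrow> T \<le> s \<Longrightarrow> s \<le> t \<Longrightarrow> \<bar>D s k * rate s k\<bar> \<le> \<beta>"
      using continuous_family_bounded[of T t "\<lambda>s k. D s k * rate s k" m]
        continuous_on_subset[OF continuous_on_mult[OF D_cont rate_cont] sub] by metis
    define S :: "real \<times> 'a \<Rightarrow> ennreal" where "S = (\<lambda>x. stopped ?K T t (fst x) (snd x))"
    define U where "U = (\<lambda>x :: real \<times> 'a. N_left (fst x) (snd x))"
    have [measurable]: "S \<in> borel_measurable PM"
      unfolding S_def by (rule stopped_predictable[OF T(1)])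
    have [measurable]: "(\<lambda>x. D (fst x) (U x)) \<in> borel_measurable PM"
      and [measurable]: "(\<lambda>x. rate (fst x) (U x)) \<in> borel_measurable PM"
      and [measurable]: "(\<lambda>x. f' (fst x) (U x)) \<in> borel_measurable PM"
      unfolding U_def by (rule function_of_N_left_predictable; intro D_cont rate_cont cont)+
    have [measurable]: "fst \<in> borel_measurable PM" by (rule fst_predictable)
    have S_region: "S (s, \<omega>) = 0 \<or> S (s, \<omega>) = 1 \<and> T < s \<and> s \<le> t \<and> U (s, \<omega>) \<in> ?K s \<and> U (s, \<omega>) \<le> m"
      if "\<omega> \<in> space M" for s \<omega>
      using N_left_in_region[OF that, of T ?K s] closed_region[OF T(1)] m[of s "U (s, \<omega>)"]
      by (auto simp: S_def stopped_def U_def)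
    \<comment> \<open>\<open>P\<close> and \<open>Q\<close> are the positive and negative parts of
      the jump increments, \<open>G\<close> is the time derivative raised by the shift in
      \<open>I\<close>, all cut off by \<open>S\<close>; \<open>H\<close> below is the guaranteed
      drift.\<close>
    define P Q G I where "P = (\<lambda>x. ennreal (D (fst x) (U x)) * S x)"
      and "Q = (\<lambda>x. ennreal (- D (fst x) (U x)) * S x)"
      and "G = (\<lambda>x. ennreal (f' (fst x) (U x) + \<kappa>) * S x)"
      and "I = (\<lambda>x. ennreal \<kappa> * S x)"
    define \<Lambda> where "\<Lambda> = (\<lambda>x. ennreal (rate (fst x) (U x)))"
    define H where "H = (\<lambda>x. ennreal (\<delta> / (fst x + 1)) * S x)"
    have meas [measurable]: "P \<in> borel_measurable PM" "Q \<in> borel_measurable PM" "G \<in> borel_measurable PM"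
      "I \<in> borel_measurable PM" "\<Lambda> \<in> borel_measurable PM" "H \<in> borel_measurable PM"
      unfolding P_def Q_def G_def I_def \<Lambda>_def H_def by measurable
    have path_ineq: "(\<integral>\<^sup>+s\<in>{0<..}. G (s, \<omega>) \<partial>lborel) + (\<integral>\<^sup>+s. P (s, \<omega>) \<partial>count_space (jump_times (\<lambda>t. N t \<omega>)))
        \<le> ((\<integral>\<^sup>+s\<in>{0<..}. I (s, \<omega>) \<partial>lborel) + ennreal (C + K0)) +
          (\<integral>\<^sup>+s. Q (s, \<omega>) \<partial>count_space (jump_times (\<lambda>t. N t \<omega>)))" if "\<omega> \<in> space M" for \<omega>
    proof -
      have "- \<kappa> \<le> f' s k" if "T \<le> s" "s \<le> t" "k \<in> ?K s" for s k
        using \<kappa>(2)[OF m[OF that] that(1,2)] by simp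
      from stopped_path_inequality[where f = f and f' = f' and \<kappa> = \<kappa> and C = C and ?K0.0 = K0 and K = ?K
          and T = T and t = t, OF \<open>\<omega> \<in> space M\<close> T t closed_region[OF T(1)] deriv cont upper lower this \<kappa>(1)]
      show ?thesis by (simp add: G_def P_def Q_def I_def S_def U_def D_def)
    qed
    \<comment> \<open>Expectation of the pathwise inequality; \<open>compensator\<close> exchanges
      jump sums for integrals against the rate.\<close>
    have "pred_integral G + pred_integral (\<lambda>x. P x * \<Lambda> x) =
        (\<integral>\<^sup>+\<omega>. (\<integral>\<^sup>+s\<in>{0<..}. G (s, \<omega>) \<partial>lborel) +
          (\<integral>\<^sup>+s. P (s, \<omega>) \<partial>count_space (jump_times (\<lambda>t. N t \<omega>))) \<partial>M)"
      using compensator[OF meas(1)]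
      by (subst nn_integral_add_left_measurable[OF predictable_integral_measurable[OF meas(3)]])
         (simp add: pred_integral_def \<Lambda>_def U_def)
    also have "\<dots> \<le> (\<integral>\<^sup>+\<omega>. ((\<integral>\<^sup>+s\<in>{0<..}. I (s, \<omega>) \<partial>lborel) + ennreal (C + K0)) +
          (\<integral>\<^sup>+s. Q (s, \<omega>) \<partial>count_space (jump_times (\<lambda>t. N t \<omega>))) \<partial>M)"
      by (rule nn_integral_mono[OF path_ineq])
    also have "\<dots> = (\<integral>\<^sup>+\<omega>. (\<integral>\<^sup>+s\<in>{0<..}. I (s, \<omega>) \<partial>lborel) + ennreal (C + K0) \<partial>M) +
        pred_integral (\<lambda>x. Q x * \<Lambda> x)"
      using compensator[OF meas(2)]
      by (subst nn_integral_add_left_measurable)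
         (auto simp: \<Lambda>_def U_def intro!: borel_measurable_add predictable_integral_measurable[OF meas(4)])
    also have "(\<integral>\<^sup>+\<omega>. (\<integral>\<^sup>+s\<in>{0<..}. I (s, \<omega>) \<partial>lborel) + ennreal (C + K0) \<partial>M) =
        pred_integral I + ennreal (C + K0)"
      by (subst nn_integral_add_left_measurable[OF predictable_integral_measurable[OF meas(4)]])
         (simp add: pred_integral_def emeasure_space_1)
    finally have le: "pred_integral G + pred_integral (\<lambda>x. P x * \<Lambda> x) \<le>
        (pred_integral I + ennreal (C + K0)) + pred_integral (\<lambda>x. Q x * \<Lambda> x)" .
    \<comment> \<open>Pointwise, the drift condition says that \<open>G + P * \<Lambda>\<close>
      exceeds \<open>I + Q * \<Lambda>\<close> by at least \<open>H\<close>.\<close>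
    have "(pred_integral I + pred_integral (\<lambda>x. Q x * \<Lambda> x)) + pred_integral H =
        pred_integral (\<lambda>x. (I x + Q x * \<Lambda> x) + H x)"
      by (simp add: pred_integral_add)
    also have "\<dots> \<le> pred_integral (\<lambda>x. G x + P x * \<Lambda> x)"
    proof (rule pred_integral_mono)
      fix s :: real and \<omega> assume s: "0 < s" and \<omega>: "\<omega> \<in> space M"
      show "(I (s, \<omega>) + Q (s, \<omega>) * \<Lambda> (s, \<omega>)) + H (s, \<omega>) \<le> G (s, \<omega>) + P (s, \<omega>) * \<Lambda> (s, \<omega>)"
      proof (cases "S (s, \<omega>) = 0")
        case True
        thus ?thesis by (simp add: I_def Q_def H_def)
      next
        case False
        define k where "k = U (s, \<omega>)"
        have S1: "S (s, \<omega>) = 1" and sr: "T < s" "s \<le> t" "k \<in> ?K s" "k \<le> m"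
          using False S_region[OF \<omega>, of s] by (auto simp: k_def)
        have L0: "0 \<le> rate s k" using s by (intro rate_nonneg) simp
        have dr: "\<delta> / (s + 1) \<le> f' s k + rate s k * D s k"
          using drift[of s k] sr by (simp add: D_def)
        have f0: "0 \<le> f' s k + \<kappa>" using \<kappa>(2)[of k s] sr by simp
        have *: "ennreal d * ennreal (rate s k) = ennreal (max 0 d * rate s k)" for d
          using L0 by (cases "0 \<le> d") (auto simp: ennreal_mult max_def ennreal_neg)
        have "\<kappa> + max 0 (- D s k) * rate s k + \<delta> / (s + 1) \<le> f' s k + \<kappa> + max 0 (D s k) * rate s k"
          using dr by (cases "0 \<le> D s k") (auto simp: max_def algebra_simps)
        hence "ennreal (\<kappa> + max 0 (- D s k) * rate s k + \<delta> / (s + 1)) \<le>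
            ennreal (f' s k + \<kappa> + max 0 (D s k) * rate s k)"
          by (rule ennreal_leI)
        moreover have "ennreal (\<kappa> + max 0 (- D s k) * rate s k + \<delta> / (s + 1)) =
            ennreal \<kappa> + ennreal (max 0 (- D s k) * rate s k) + ennreal (\<delta> / (s + 1))"
          using \<kappa>(1) L0 \<delta> s by (simp add: ennreal_plus)
        moreover have "ennreal (f' s k + \<kappa> + max 0 (D s k) * rate s k) =
            ennreal (f' s k + \<kappa>) + ennreal (max 0 (D s k) * rate s k)"
          using f0 L0 by (intro ennreal_plus) auto
        ultimately show ?thesis
          by (simp add: I_def Q_def H_def G_def P_def \<Lambda>_def S1 k_def[symmetric] *)
      qed
    qed
    also have "\<dots> = pred_integral G + pred_integral (\<lambda>x. P x * \<Lambda> x)"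
      by (simp add: pred_integral_add)
    also note le
    also have "(pred_integral I + ennreal (C + K0)) + pred_integral (\<lambda>x. Q x * \<Lambda> x) =
        (pred_integral I + pred_integral (\<lambda>x. Q x * \<Lambda> x)) + ennreal (C + K0)"
      by (simp add: ac_simps)
    finally have le2: "(pred_integral I + pred_integral (\<lambda>x. Q x * \<Lambda> x)) + pred_integral H \<le>
        (pred_integral I + pred_integral (\<lambda>x. Q x * \<Lambda> x)) + ennreal (C + K0)" .
    \<comment> \<open>The common part must be finite before it can be cancelled; stopping at
      \<open>t\<close> in a region with finitely many states bounds it.\<close>
    have "pred_integral (\<lambda>x. I x + Q x * \<Lambda> x) \<le> pred_integral (\<lambda>x. ennreal (\<kappa> + \<beta>) * indicator {T<..t} (fst x))"
    proof (rule pred_integral_mono)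
      fix s :: real and \<omega> assume s: "0 < s" and \<omega>: "\<omega> \<in> space M"
      show "I (s, \<omega>) + Q (s, \<omega>) * \<Lambda> (s, \<omega>) \<le> ennreal (\<kappa> + \<beta>) * indicator {T<..t} (fst (s, \<omega>))"
      proof (cases "S (s, \<omega>) = 0")
        case True
        thus ?thesis by (simp add: I_def Q_def)
      next
        case False
        define k where "k = U (s, \<omega>)"
        have S1: "S (s, \<omega>) = 1" and sr: "T < s" "s \<le> t" "k \<in> ?K s" "k \<le> m"
          using False S_region[OF \<omega>, of s] by (auto simp: k_def)
        have L0: "0 \<le> rate s k" using s by (intro rate_nonneg) simp
        have "ennreal (- D s k) * ennreal (rate s k) = ennreal (- D s k * rate s k)"
          by (rule ennreal_mult''[OF L0, symmetric])
        also have "\<dots> \<le> ennreal \<beta>"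
          using \<beta>(2)[of k s] sr by (intro ennreal_leI) auto
        finally have "ennreal \<kappa> + ennreal (- D s k) * ennreal (rate s k) \<le> ennreal \<kappa> + ennreal \<beta>"
          by (rule add_left_mono)
        thus ?thesis using sr \<kappa>(1) \<beta>(1)
          by (simp add: I_def Q_def \<Lambda>_def S1 k_def[symmetric] ennreal_plus)
      qed
    qed
    also have "\<dots> = ennreal (\<kappa> + \<beta>) * ennreal (t - T)"
    proof -
      have "(\<integral>\<^sup>+s\<in>{0<..}. ennreal (\<kappa> + \<beta>) * indicator {T<..t} s \<partial>lborel) =
          (\<integral>\<^sup>+s. ennreal (\<kappa> + \<beta>) * indicator {T<..t} s \<partial>lborel)"
        using T by (intro nn_integral_cong) (auto simp: indicator_def)
      also have "\<dots> = ennreal (\<kappa> + \<beta>) * ennreal (t - T)"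
        using t by (subst nn_integral_cmult_indicator) auto
      finally show ?thesis by (simp add: pred_integral_def emeasure_space_1)
    qed
    finally have "pred_integral I + pred_integral (\<lambda>x. Q x * \<Lambda> x) \<le> ennreal (\<kappa> + \<beta>) * ennreal (t - T)"
      by (subst (asm) pred_integral_add) auto
    also have "\<dots> < \<infinity>" by (simp add: ennreal_mult_less_top)
    finally have fin: "pred_integral I + pred_integral (\<lambda>x. Q x * \<Lambda> x) < \<infinity>" .
    have H_le: "pred_integral H \<le> ennreal (C + K0)"
      using le2 fin by (subst (asm) ennreal_add_left_cancel_le) auto
    \<comment> \<open>On \<open>A\<close> the path never leaves the region, so \<open>S\<close> is
      one on all of \<open>(T, t]\<close> and the integral of \<open>H\<close> dominates the
      logarithm.\<close>
    have "emeasure M A * ennreal (\<delta> * ln ((t + 1) / (T + 1))) =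
        (\<integral>\<^sup>+\<omega>. ennreal (\<delta> * ln ((t + 1) / (T + 1))) * indicator A \<omega> \<partial>M)"
      by (subst nn_integral_cmult_indicator[OF A]) (rule mult.commute)
    also have "\<dots> \<le> pred_integral H"
      unfolding pred_integral_def
    proof (rule nn_integral_mono)
      fix \<omega> assume \<omega>: "\<omega> \<in> space M"
      have "ennreal (\<delta> * ln ((t + 1) / (T + 1))) \<le> (\<integral>\<^sup>+s\<in>{0<..}. H (s, \<omega>) \<partial>lborel)" if "\<omega> \<in> A"
      proof -
        have "(\<integral>\<^sup>+s\<in>{T<..t}. ennreal (\<delta> / (s + 1)) \<partial>lborel) = ennreal (\<delta> * ln (t + 1) - \<delta> * ln (T + 1))"
        proof (rule nn_integral_FTC_Ioc(2)[where F = "\<lambda>s. \<delta> * ln (s + 1)"])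
          show "((\<lambda>s. \<delta> * ln (s + 1)) has_real_derivative \<delta> / (s + 1)) (at s)" if "T \<le> s" for s
            using that T by (auto intro!: derivative_eq_intros)
          show "continuous_on {T..t} (\<lambda>s. \<delta> / (s + 1))"
            using T by (intro continuous_intros) auto
        qed (use T t \<delta> in auto)
        also have "\<delta> * ln (t + 1) - \<delta> * ln (T + 1) = \<delta> * ln ((t + 1) / (T + 1))"
          using T t by (simp add: ln_div algebra_simps)
        finally have "(\<integral>\<^sup>+s\<in>{T<..t}. ennreal (\<delta> / (s + 1)) \<partial>lborel) =
            ennreal (\<delta> * ln ((t + 1) / (T + 1)))" .
        moreover have "(\<integral>\<^sup>+s\<in>{T<..t}. ennreal (\<delta> / (s + 1)) \<partial>lborel) \<le> (\<integral>\<^sup>+s\<in>{0<..}. H (s, \<omega>) \<partial>lborel)"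
          using that T by (intro nn_integral_mono)
            (auto simp: H_def S_def stopped_def stay_def A_def indicator_def)
        ultimately show ?thesis by simp
      qed
      thus "ennreal (\<delta> * ln ((t + 1) / (T + 1))) * indicator A \<omega> \<le> (\<integral>\<^sup>+s\<in>{0<..}. H (s, \<omega>) \<partial>lborel)"
        by (auto simp: indicator_def)
    qed
    also note H_le
    finally show ?thesis .
  qed
  have "emeasure M A = 0"
  proof (rule ccontr)
    assume "emeasure M A \<noteq> 0"
    hence p: "0 < measure M A" by (simp add: emeasure_eq_measure less_le)
    have le: "measure M A * (\<delta> * ln ((t + 1) / (T + 1))) \<le> max 0 (C + K0)" if "T < t" for t
    proof -
      have "0 \<le> \<delta> * ln ((t + 1) / (T + 1))" using that T \<delta> by (intro mult_nonneg_nonneg ln_ge_zero) auto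
      hence "ennreal (measure M A * (\<delta> * ln ((t + 1) / (T + 1)))) \<le> ennreal (C + K0)"
        using main[OF that] by (simp add: emeasure_eq_measure ennreal_mult)
      thus ?thesis by (cases "0 \<le> C + K0") (auto simp: ennreal_le_iff ennreal_neg max_def ennreal_eq_0_iff)
    qed
    \<comment> \<open>\<open>y\<close> is the value of \<open>ln ((t + 1) / (T + 1))\<close> at
      which the left-hand side of \<open>le\<close> exceeds the bound by one.\<close>
    define y where "y = (max 0 (C + K0) + 1) / (measure M A * \<delta>)"
    have y: "0 < y" using p \<delta> by (auto simp: y_def intro!: divide_pos_pos mult_pos_pos)
    define t where "t = (T + 1) * exp y - 1"
    have "T + 1 < (T + 1) * exp y" using y T by simp
    hence tT: "T < t" by (simp add: t_def)
    have "(t + 1) / (T + 1) = exp y" using T by (simp add: t_def)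
    with le[OF tT] have "measure M A * (\<delta> * y) \<le> max 0 (C + K0)" by simp
    moreover have "measure M A * (\<delta> * y) = max 0 (C + K0) + 1" using p \<delta> by (simp add: y_def)
    ultimately show False by simp
  qed
  hence "AE \<omega> in M. \<omega> \<notin> A" using A by (intro AE_not_in) (simp add: null_sets_def)
  with AE_space show ?thesis by eventually_elim (auto simp: A_def)
qed


section \<open>The Lyapunov functions at a zero and at a positive fixed point\<close>

lemma zero_unstable_stay_null:
  assumes \<gamma>: "\<gamma> \<noteq> 0" and b: "1 < b" and \<epsilon>: "0 < \<epsilon>" "\<epsilon> \<le> 1"
    and expand: "\<And>z. 0 \<le> z \<Longrightarrow> \<bar>z\<bar> \<le> \<epsilon> \<Longrightarrow> b * z\<^sup>2 \<le> lam z * z"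
    and T: "0 \<le> T" "T \<in> \<rat>"
  shows "AE \<omega> in M. \<not> (\<forall>r\<in>\<rat>. T \<le> r \<longrightarrow> N r \<omega> \<in> region 0 \<epsilon> r)"
proof -
  define f f' where "f = (\<lambda>(s::real) k. ln (real k + \<gamma>) - 1 / (real k + \<gamma>) - ln (s + 1))"
    and "f' = (\<lambda>(s::real) (k::nat). - 1 / (s + 1))"
  \<comment> \<open>\<open>\<gamma> > 0\<close> keeps the logarithm and the reciprocal meaningful
    even in state \<open>0\<close>.\<close>
  have Y: "0 < real k + \<gamma>" for k using \<gamma> \<gamma>_nonneg by (simp add: add_nonneg_pos)
  show ?thesis
  proof (rule stay_null[where f = f and f' = f' and \<delta> = "b - 1" and C = "ln 2"])
    show "((\<lambda>s. f s k) has_real_derivative f' s k) (at s)" if "0 \<le> s" for k s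
      unfolding f_def f'_def using that by (auto intro!: derivative_eq_intros)
    show "continuous_on {0..} (\<lambda>s. f' s k)" for k
      unfolding f'_def by (auto intro!: continuous_intros)
    \<comment> \<open>In the region \<open>k + \<gamma> \<le> s + 1\<close>, and after one more jump
      the value is still at most \<open>2 * (s + 1)\<close>; hence \<open>C = ln 2\<close>.\<close>
    have ub: "f s k \<le> ln 2" if "0 \<le> s" "real k + \<gamma> \<le> 2 * (s + 1)" for s k
    proof -
      have "ln (real k + \<gamma>) \<le> ln (2 * (s + 1))" using that Y[of k] by simp
      also have "\<dots> = ln 2 + ln (s + 1)" using that by (intro ln_mult_pos) auto
      also have "ln 2 + ln (s + 1) \<le> ln 2 + ln (s + 1) + 1 / (real k + \<gamma>)" using Y[of k] by simp
      finally show ?thesis by (simp add: f_def)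
    qed
    show "f s k \<le> ln 2 \<and> f s (Suc k) \<le> ln 2" if "T \<le> s" "k \<in> region 0 \<epsilon> s" for s k
    proof -
      have "\<bar>(real k + \<gamma>) / (s + 1) - 0\<bar> \<le> \<epsilon>" using that(2) unfolding region_def by blast
      hence "(real k + \<gamma>) / (s + 1) \<le> 1" using \<epsilon>(2) by linarith
      hence "real k + \<gamma> \<le> s + 1" using that T by (simp add: divide_le_eq)
      thus ?thesis using that T by (intro conjI ub) auto
    qed
    show "(b - 1) / (s + 1) \<le> f' s k + rate s k * (f s (Suc k) - f s k)"
      if "T \<le> s" "k \<in> region 0 \<epsilon> s" for s k
    proof -
      let ?X = "(real k + \<gamma>) / (s + 1)"
      have s: "0 < s + 1" using that T by simp
      have X: "0 < ?X" using Y[of k] s by simp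
      have "b * ?X\<^sup>2 \<le> lam ?X * ?X" using that X by (intro expand) (auto simp: region_def)
      moreover have "b * z \<le> lam z" if "b * z\<^sup>2 \<le> lam z * z" "0 < z" for z
        using that mult_right_le_imp_le[of "b * z" z "lam z"] by (simp add: power2_eq_square mult.assoc)
      ultimately have "b * ?X \<le> rate s k" using X unfolding rate_def by blast
      from log_drift_at_zero[OF Y s this] rate_nonneg[of s k] that T
      show ?thesis by (simp add: f_def f'_def algebra_simps)
    qed
  qed (use T b in auto)
qed

text \<open>\<open>expand\<close> bounds the chord slopes of \<open>lam\<close> at \<open>x\<close>
  below by \<open>b\<close>, without distinguishing the sides of \<open>x\<close>. The restrictions
  on \<open>\<epsilon>\<close> and \<open>T\<close> make \<open>\<bar>y\<bar> / v\<close> and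
  \<open>1 / v\<close> as small as \<open>lyap_drift\<close> asks.\<close>

lemma positive_unstable_stay_null:
  assumes x: "0 < x" and b: "1 < b" and \<epsilon>: "0 < \<epsilon>" "\<epsilon> \<le> x / 4" "\<epsilon> \<le> 1 / 8"
    and expand: "\<And>z. 0 \<le> z \<Longrightarrow> \<bar>z - x\<bar> \<le> \<epsilon> \<Longrightarrow> b * (z - x)\<^sup>2 \<le> (lam z - x) * (z - x)"
    and near: "\<And>z. 0 \<le> z \<Longrightarrow> \<bar>z - x\<bar> \<le> \<epsilon> \<Longrightarrow> \<bar>lam z - x\<bar> \<le> x / 4"
    and T: "4 / x \<le> T" "4 \<le> T" "T \<in> \<rat>"
  shows "AE \<omega> in M. \<not> (\<forall>r\<in>\<rat>. T \<le> r \<longrightarrow> N r \<omega> \<in> region x \<epsilon> r)"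
proof -
  define C0 where "C0 = 5 / 2 * x * (4 + 5 / 4 * x)"
  define \<theta> where "\<theta> = 1 / (16 * x)"
  define B where "B = 32 * exp (\<theta> * ((C0 + 1) / (b - 1) + 1)) * ((C0 + 1) / 2 + (b - 1) / 2)"
  have B0: "0 \<le> B" using x b by (simp add: B_def C0_def)
  define Y where "Y = (\<lambda>s k. real k + \<gamma> - x * (s + 1))"
  define q where "q = (\<lambda>s k. (Y s k)\<^sup>2 / (s + 1))"
  \<comment> \<open>Time derivative of \<open>q\<close> in a fixed state, where \<open>Y\<close>
    decreases at speed \<open>x\<close>.\<close>
  define q' where "q' = (\<lambda>s k. - 2 * x * Y s k / (s + 1) - (Y s k)\<^sup>2 / (s + 1)\<^sup>2)"
  define f where "f = (\<lambda>s k. lyap B \<theta> (q s k) - ln (s + 1) / 2)"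
  define f' where "f' = (\<lambda>s k. (1 / (2 * (q s k + 1)) + B * \<theta> * exp (- \<theta> * q s k)) * q' s k - 1 / (2 * (s + 1)))"
  have q0: "0 \<le> q s k" if "0 \<le> s" for s k using that by (simp add: q_def)
  have Y_le: "\<bar>Y s k\<bar> / (s + 1) \<le> \<epsilon>" if "0 \<le> s" "k \<in> region x \<epsilon> s" for s k
  proof -
    have "Y s k / (s + 1) = (real k + \<gamma>) / (s + 1) - x" using that by (simp add: Y_def field_simps)
    moreover have "\<bar>Y s k\<bar> / (s + 1) = \<bar>Y s k / (s + 1)\<bar>" using that by simp
    ultimately show ?thesis using that by (simp add: region_def)
  qed
  show ?thesis
  proof (rule stay_null[where f = f and f' = f' and \<delta> = "(b - 1) / 2" and C = "ln 2 / 2"])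
    show "((\<lambda>s. f s k) has_real_derivative f' s k) (at s)" if s: "0 \<le> s" for k s
    proof -
      have "((\<lambda>s. q s k) has_real_derivative q' s k) (at s)"
      proof -
        have "((\<lambda>s. Y s k) has_real_derivative - x) (at s)"
          unfolding Y_def by (auto intro!: derivative_eq_intros)
        hence "((\<lambda>s. q s k) has_real_derivative
            (2 * (Y s k * (- x)) * (s + 1) - (Y s k)\<^sup>2) / (s + 1)\<^sup>2) (at s)"
          unfolding q_def using s
          by (auto intro!: derivative_eq_intros simp: power2_eq_square)
        moreover have "(2 * (y * (- x)) * v - y\<^sup>2) / v\<^sup>2 = - 2 * x * y / v - y\<^sup>2 / v\<^sup>2"
          if "0 < v" for y v :: real
          using that by (simp add: field_simps power2_eq_square)
        ultimately show ?thesis using s by (simp add: q'_def)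
      qed
      from DERIV_chain2[OF lyap_has_derivative[OF q0[OF s]] this, of B \<theta>]
      have "((\<lambda>s. lyap B \<theta> (q s k)) has_real_derivative
          (1 / (2 * (q s k + 1)) + B * \<theta> * exp (- \<theta> * q s k)) * q' s k) (at s)" .
      moreover have "((\<lambda>s. ln (s + 1) / 2) has_real_derivative 1 / (2 * (s + 1))) (at s)"
        using s by (auto intro!: derivative_eq_intros simp: field_simps)
      ultimately show ?thesis unfolding f_def f'_def by (rule DERIV_diff)
    qed
    show "continuous_on {0..} (\<lambda>s. f' s k)" for k
    proof -
      have "2 * q s k + 2 \<noteq> 0" if "0 \<le> s" for s using q0[OF that, of k] by linarith
      moreover have "continuous_on {0..} (\<lambda>s. q s k)" "continuous_on {0..} (\<lambda>s. q' s k)"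
        unfolding q_def q'_def Y_def by (auto intro!: continuous_intros)
      ultimately show ?thesis unfolding f'_def by (auto intro!: continuous_intros)
    qed
    \<comment> \<open>A deviation of at most \<open>(s + 1) / 8\<close> is at most
      \<open>s + 1\<close> after a jump, so \<open>q + 1 \<le> 2 * (s + 1)\<close>; subtracting
      \<open>ln (s + 1) / 2\<close> leaves \<open>ln 2 / 2\<close>.\<close>
    show "f s k \<le> ln 2 / 2 \<and> f s (Suc k) \<le> ln 2 / 2" if "T \<le> s" "k \<in> region x \<epsilon> s" for s k
    proof -
      have s: "4 \<le> s" using that T by simp
      have "\<bar>Y s k\<bar> / (s + 1) \<le> 1 / 8"
        using Y_le[OF _ that(2)] s \<epsilon>(3) by linarith
      hence Yk: "\<bar>Y s k\<bar> \<le> (s + 1) / 8" using s by (simp add: divide_le_eq)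
      have ub: "f s j \<le> ln 2 / 2" if "\<bar>Y s j\<bar> \<le> s + 1" for j
      proof -
        have "(Y s j)\<^sup>2 \<le> (s + 1)\<^sup>2" using that s by (simp add: abs_le_square_iff[symmetric])
        hence "q s j \<le> s + 1" using s by (simp add: q_def divide_le_eq power2_eq_square)
        hence "ln (q s j + 1) \<le> ln (2 * (s + 1))" using q0[of s j] s by simp
        also have "\<dots> = ln 2 + ln (s + 1)" using s by (intro ln_mult_pos) auto
        finally have "ln (q s j + 1) / 2 - ln (s + 1) / 2 \<le> ln 2 / 2" by simp
        moreover have "0 \<le> B * exp (- \<theta> * q s j)" using B0 by simp
        ultimately show ?thesis unfolding f_def lyap_def by linarith
      qed
      have "Y s (Suc k) = Y s k + 1" by (simp add: Y_def)
      hence "\<bar>Y s (Suc k)\<bar> \<le> s + 1" using Yk s abs_triangle_ineq[of "Y s k" 1] by simp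
      thus ?thesis using Yk s by (intro conjI ub) auto
    qed
    show "(b - 1) / 2 / (s + 1) \<le> f' s k + rate s k * (f s (Suc k) - f s k)"
      if "T \<le> s" "k \<in> region x \<epsilon> s" for s k
    proof -
      let ?X = "(real k + \<gamma>) / (s + 1)"
      have s: "4 \<le> s" "4 / x \<le> s" using that T by auto
      have X: "0 \<le> ?X" "\<bar>?X - x\<bar> \<le> \<epsilon>" using that s \<gamma>_nonneg by (auto simp: region_def)
      have YX: "Y s k = (s + 1) * (?X - x)" using s by (simp add: Y_def field_simps)
      have "1 / (s + 1) \<le> x / 4" using s x by (simp add: field_simps add_increasing)
      moreover have "1 / (s + 1) \<le> 1 / 4" using s by (simp add: field_simps)
      moreover have "\<bar>Y s k\<bar> / (s + 1) \<le> x / 4" "\<bar>Y s k\<bar> / (s + 1) \<le> 1 / 8"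
        using Y_le[OF _ that(2)] s(1) \<epsilon>(2,3) by linarith+
      moreover have "\<bar>rate s k - x\<bar> \<le> x / 4" unfolding rate_def by (rule near[OF X])
      moreover have "b * ((Y s k)\<^sup>2 / (s + 1)) \<le> (rate s k - x) * Y s k"
      proof -
        \<comment> \<open>Multiplying \<open>expand\<close> by \<open>v = s + 1\<close> translates
          it from \<open>?X - x\<close> to \<open>Y\<close>.\<close>
        have "b * ((v * w)\<^sup>2 / v) \<le> l * (v * w)" if "b * w\<^sup>2 \<le> l * w" "0 < v" for v w l :: real
          using mult_left_mono[OF that(1), of v] that(2) by (simp add: power2_eq_square mult_ac)
        from this[OF expand[OF X], of "s + 1"] show ?thesis unfolding rate_def YX using s(1) by simp
      qed
      ultimately have "(b - 1) / 2 / (s + 1) \<le>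
          (1 / (2 * ((Y s k)\<^sup>2 / (s + 1) + 1)) + B * \<theta> * exp (- \<theta> * ((Y s k)\<^sup>2 / (s + 1)))) *
            (- 2 * x * Y s k / (s + 1) - (Y s k)\<^sup>2 / (s + 1)\<^sup>2) - 1 / (2 * (s + 1)) +
          rate s k * (lyap B \<theta> ((Y s k + 1)\<^sup>2 / (s + 1)) - lyap B \<theta> ((Y s k)\<^sup>2 / (s + 1)))"
        using lyap_drift[of x b "s + 1" "Y s k" "rate s k"] x b s
        unfolding B_def \<theta>_def C0_def by simp
      moreover have "Y s (Suc k) = Y s k + 1" by (simp add: Y_def)
      ultimately show ?thesis by (simp add: f_def f'_def q_def q'_def)
    qed
  qed (use T b in auto)
qed

text \<open>Any \<open>b\<close> strictly between \<open>1\<close> and \<open>D\<close> bounds the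
  difference quotients near \<open>x\<close> from below; multiplying by the square
  \<open>(z - x)\<^sup>2\<close> removes the dependence on the sign of \<open>z - x\<close>.\<close>

lemma unstable_stay_null:
  assumes x: "0 \<le> x" "x = lam x" "x \<noteq> 0 \<or> \<gamma> \<noteq> 0"
    and deriv: "(lam has_real_derivative D) (at x within {0..})" "1 < D"
  obtains \<epsilon> T0 where "0 < \<epsilon>"
    "\<And>T. T0 \<le> T \<Longrightarrow> T \<in> \<rat> \<Longrightarrow> AE \<omega> in M. \<not> (\<forall>r\<in>\<rat>. T \<le> r \<longrightarrow> N r \<omega> \<in> region x \<epsilon> r)"
proof -
  obtain b where b: "1 < b" "b < D" using dense[OF deriv(2)] by blast
  have "((\<lambda>y. (lam y - lam x) / (y - x)) \<longlongrightarrow> D) (at x within {0..})"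
    using deriv(1) by (simp add: has_field_derivative_iff)
  from order_tendstoD(1)[OF this b(2)] obtain e where e: "0 < e"
    "\<And>y. 0 \<le> y \<Longrightarrow> y \<noteq> x \<Longrightarrow> \<bar>y - x\<bar> < e \<Longrightarrow> b < (lam y - x) / (y - x)"
    using x(2) by (auto simp: eventually_at dist_real_def)
  have expand: "b * (z - x)\<^sup>2 \<le> (lam z - x) * (z - x)" if "0 \<le> z" "\<bar>z - x\<bar> < e" for z
  proof (cases "z = x")
    case False
    have "b * (z - x)\<^sup>2 \<le> (lam z - x) / (z - x) * (z - x)\<^sup>2"
      using e(2)[OF that(1) False that(2)] by (intro mult_right_mono) auto
    also have "\<dots> = (lam z - x) * (z - x)" using False by (simp add: power2_eq_square)
    finally show ?thesis .
  qed simp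
  show ?thesis
  proof (cases "x = 0")
    case True
    define \<epsilon> where "\<epsilon> = min (e / 2) 1"
    show ?thesis
    proof (rule that[of \<epsilon> 0])
      show "0 < \<epsilon>" using e(1) by (simp add: \<epsilon>_def)
      show "AE \<omega> in M. \<not> (\<forall>r\<in>\<rat>. T \<le> r \<longrightarrow> N r \<omega> \<in> region x \<epsilon> r)" if "0 \<le> T" "T \<in> \<rat>" for T
        unfolding True
      proof (rule zero_unstable_stay_null[OF _ b(1) _ _ _ that])
        show "b * z\<^sup>2 \<le> lam z * z" if "0 \<le> z" "\<bar>z\<bar> \<le> \<epsilon>" for z
          using expand[of z] that e(1) True by (auto simp: \<epsilon>_def)
      qed (use e x True in \<open>auto simp: \<epsilon>_def\<close>)
    qed
  next
    case False
    hence x0: "0 < x" using x by simp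
    have "(lam \<longlongrightarrow> lam x) (at x within {0..})"
      using DERIV_continuous[OF deriv(1)] by (simp add: continuous_within)
    from tendstoD[OF this, of "x / 4"] x0 obtain d where d: "0 < d"
      "\<And>y. 0 \<le> y \<Longrightarrow> y \<noteq> x \<Longrightarrow> \<bar>y - x\<bar> < d \<Longrightarrow> \<bar>lam y - x\<bar> < x / 4"
      using x(2) by (auto simp: eventually_at dist_real_def)
    \<comment> \<open>The halves turn the open radii \<open>e\<close> and \<open>d\<close> into
      closed ones; \<open>x / 4\<close> and \<open>1 / 8\<close> are the limits set by the drift
      estimate.\<close>
    define \<epsilon> where "\<epsilon> = Min {e / 2, d / 2, x / 4, 1 / 8}"
    have \<epsilon>: "0 < \<epsilon>" "\<epsilon> < e" "\<epsilon> < d" "\<epsilon> \<le> x / 4" "\<epsilon> \<le> 1 / 8"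
      using e(1) d(1) x0 by (auto simp: \<epsilon>_def min_def)
    show ?thesis
    proof (rule that[of \<epsilon> "max (4 / x) 4"])
      show "AE \<omega> in M. \<not> (\<forall>r\<in>\<rat>. T \<le> r \<longrightarrow> N r \<omega> \<in> region x \<epsilon> r)"
        if "max (4 / x) 4 \<le> T" "T \<in> \<rat>" for T
      proof (rule positive_unstable_stay_null[OF x0 b(1) \<epsilon>(1) \<epsilon>(4,5)])
        show "b * (z - x)\<^sup>2 \<le> (lam z - x) * (z - x)" if "0 \<le> z" "\<bar>z - x\<bar> \<le> \<epsilon>" for z
          using that \<epsilon> by (intro expand) auto
        show "\<bar>lam z - x\<bar> \<le> x / 4" if "0 \<le> z" "\<bar>z - x\<bar> \<le> \<epsilon>" for z
          using d(2)[of z] that \<epsilon> x x0 by (cases "z = x") auto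
      qed (use that in auto)
    qed (rule \<epsilon>(1))
  qed
qed

section \<open>From convergence of the mean to staying near the fixed point\<close>

lemma mean_tendsto_iff_sequence:
  assumes "\<omega> \<in> space M"
  shows "((\<lambda>t. real (N t \<omega>) / t) \<longlongrightarrow> x) at_top \<longleftrightarrow> (\<lambda>n. real (N (real n) \<omega>) / real n) \<longlonglongrightarrow> x"
proof
  assume "((\<lambda>t. real (N t \<omega>) / t) \<longlongrightarrow> x) at_top"
  thus "(\<lambda>n. real (N (real n) \<omega>) / real n) \<longlonglongrightarrow> x"
    by (rule filterlim_compose[OF _ filterlim_real_sequentially])
next
  let ?c = "\<lambda>n. real (N (real n) \<omega>)"
  assume lim: "(\<lambda>n. ?c n / real n) \<longlonglongrightarrow> x"
  \<comment> \<open>With \<open>n\<close> the integer part of \<open>t\<close>, monotonicity puts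
    \<open>N t / t\<close> between \<open>N n / (n + 1)\<close> and \<open>N (n + 1) / n\<close>;
    the ratio \<open>n / (n + 1)\<close> relates both to the sequence.\<close>
  have r: "(\<lambda>n. real n / real (Suc n)) \<longlonglongrightarrow> 1" by (rule LIMSEQ_n_over_Suc_n)
  have lower: "(\<lambda>n. ?c n / real n * (real n / real (Suc n))) \<longlonglongrightarrow> x"
    using tendsto_mult[OF lim r] by simp
  have upper: "(\<lambda>n. ?c (Suc n) / real (Suc n) / (real n / real (Suc n))) \<longlonglongrightarrow> x"
    using tendsto_divide[OF LIMSEQ_Suc[OF lim] r] by simp
  have fl: "filterlim (\<lambda>t::real. nat \<lfloor>t\<rfloor>) at_top at_top"
    by (intro filterlim_compose[OF filterlim_nat_sequentially filterlim_floor_sequentially])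
  have N_mono: "N a \<omega> \<le> N b \<omega>" if "a \<le> b" for a b
    using monoD[OF path(1)[OF assms] that] .
  show "((\<lambda>t. real (N t \<omega>) / t) \<longlongrightarrow> x) at_top"
  proof (rule tendsto_sandwich[OF _ _ filterlim_compose[OF lower fl] filterlim_compose[OF upper fl]])
    show "\<forall>\<^sub>F t in at_top. ?c (nat \<lfloor>t\<rfloor>) / real (nat \<lfloor>t\<rfloor>) * (real (nat \<lfloor>t\<rfloor>) / real (Suc (nat \<lfloor>t\<rfloor>))) \<le> real (N t \<omega>) / t"
      using eventually_ge_at_top[of 1]
    proof eventually_elim
      case (elim t)
      define n where "n = nat \<lfloor>t\<rfloor>"
      have n: "1 \<le> n" "real n \<le> t" "t \<le> real (Suc n)" using elim unfolding n_def by linarith+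
      have "?c n / real n * (real n / real (Suc n)) = ?c n / real (Suc n)" using n by simp
      also have "\<dots> \<le> real (N t \<omega>) / t"
        using n N_mono[of "real n" t] by (intro frac_le) auto
      finally show ?case by (simp add: n_def)
    qed
    show "\<forall>\<^sub>F t in at_top. real (N t \<omega>) / t \<le> ?c (Suc (nat \<lfloor>t\<rfloor>)) / real (Suc (nat \<lfloor>t\<rfloor>)) / (real (nat \<lfloor>t\<rfloor>) / real (Suc (nat \<lfloor>t\<rfloor>)))"
      using eventually_ge_at_top[of 1]
    proof eventually_elim
      case (elim t)
      define n where "n = nat \<lfloor>t\<rfloor>"
      have n: "1 \<le> n" "real n \<le> t" "t \<le> real (Suc n)" using elim unfolding n_def by linarith+
      have "real (N t \<omega>) / t \<le> ?c (Suc n) / real n"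
        using n N_mono[of t "real (Suc n)"] by (intro frac_le) auto
      also have "\<dots> = ?c (Suc n) / real (Suc n) / (real n / real (Suc n))" using n by simp
      finally show ?case by (simp add: n_def)
    qed
  qed
qed

text \<open>The variable \<open>(N + \<gamma>) / (t + 1)\<close> of the region has the same limit as
  \<open>N / t\<close>. The starting time is a natural number so that it is rational and ranges over
  a countable set.\<close>

lemma mean_tendsto_imp_stay:
  assumes lim: "((\<lambda>t. real (N t \<omega>) / t) \<longlongrightarrow> x) at_top" and \<epsilon>: "0 < \<epsilon>"
  shows "\<exists>n::nat. T0 \<le> real n \<and> (\<forall>r\<in>\<rat>. real n \<le> r \<longrightarrow> N r \<omega> \<in> region x \<epsilon> r)"
proof -
  have 0: "((\<lambda>t::real. c / (t + 1)) \<longlongrightarrow> 0) at_top" for c :: real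
  proof -
    have "filterlim (\<lambda>t::real. t + 1) at_top at_top"
      using filterlim_tendsto_add_at_top[OF tendsto_const[of 1] filterlim_ident]
      by (simp add: add.commute)
    thus ?thesis by (intro tendsto_divide_0[OF tendsto_const] filterlim_at_top_imp_at_infinity)
  qed
  have "((\<lambda>t::real. 1 - 1 / (t + 1)) \<longlongrightarrow> 1 - 0) at_top" by (intro tendsto_intros 0)
  hence 1: "((\<lambda>t::real. t / (t + 1)) \<longlongrightarrow> 1) at_top"
  proof (rule Lim_transform_eventually[THEN tendsto_eq_rhs])
    have "1 - 1 / (t + 1) = t / (t + 1)" if "0 < t" for t :: real using that by (simp add: field_simps)
    thus "\<forall>\<^sub>F t::real in at_top. 1 - 1 / (t + 1) = t / (t + 1)"
      by (intro eventually_mono[OF eventually_gt_at_top[of 0]])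
  qed simp
  have "((\<lambda>t. real (N t \<omega>) / t * (t / (t + 1)) + \<gamma> / (t + 1)) \<longlongrightarrow> x * 1 + 0) at_top"
    by (intro tendsto_intros lim 0 1)
  hence "\<forall>\<^sub>F t in at_top. dist (real (N t \<omega>) / t * (t / (t + 1)) + \<gamma> / (t + 1)) (x * 1 + 0) < \<epsilon>"
    using \<epsilon> by (rule tendstoD)
  then obtain R where R: "\<And>t. R \<le> t \<Longrightarrow> dist (real (N t \<omega>) / t * (t / (t + 1)) + \<gamma> / (t + 1)) (x * 1 + 0) < \<epsilon>"
    by (auto simp: eventually_at_top_linorder)
  obtain n :: nat where n: "max (max R T0) 1 \<le> real n" using real_arch_simple by blast
  have "N r \<omega> \<in> region x \<epsilon> r" if "real n \<le> r" for r
  proof -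
    have "real (N r \<omega>) / r * (r / (r + 1)) + \<gamma> / (r + 1) = (real (N r \<omega>) + \<gamma>) / (r + 1)"
      using that n by (simp add: add_divide_distrib)
    thus ?thesis using R[of r] that n by (simp add: region_def dist_real_def)
  qed
  thus ?thesis using n by auto
qed

theorem unstable_limit_null:
  assumes x: "0 \<le> x" "x = lam x" "x \<noteq> 0 \<or> \<gamma> \<noteq> 0"
    and deriv: "(lam has_real_derivative D) (at x within {0..})" "1 < D"
  shows "{\<omega> \<in> space M. ((\<lambda>t. real (N t \<omega>) / t) \<longlongrightarrow> x) at_top} \<in> null_sets M"
proof -
  let ?E = "{\<omega> \<in> space M. ((\<lambda>t. real (N t \<omega>) / t) \<longlongrightarrow> x) at_top}"
  have "?E = {\<omega> \<in> space M. (\<lambda>n. real (N (real n) \<omega>) / real n) \<longlonglongrightarrow> x}"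
    using mean_tendsto_iff_sequence by blast
  \<comment> \<open>Along the integers, convergence involves only countably many random
    variables.\<close>
  also have "\<dots> \<in> sets M" by measurable
  finally have E: "?E \<in> sets M" .
  obtain \<epsilon> T0 where \<epsilon>: "0 < \<epsilon>" and
    null: "\<And>T. T0 \<le> T \<Longrightarrow> T \<in> \<rat> \<Longrightarrow> AE \<omega> in M. \<not> (\<forall>r\<in>\<rat>. T \<le> r \<longrightarrow> N r \<omega> \<in> region x \<epsilon> r)"
    using unstable_stay_null[OF x deriv] by blast
  \<comment> \<open>Convergence would force the path to stay in the region from some integer time
    on, and the union over these countably many times is null.\<close>
  have "AE \<omega> in M. T0 \<le> real n \<longrightarrow> \<not> (\<forall>r\<in>\<rat>. real n \<le> r \<longrightarrow> N r \<omega> \<in> region x \<epsilon> r)" for n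
    using null[of "real n"] by (cases "T0 \<le> real n") auto
  hence "AE \<omega> in M. \<forall>n. T0 \<le> real n \<longrightarrow> \<not> (\<forall>r\<in>\<rat>. real n \<le> r \<longrightarrow> N r \<omega> \<in> region x \<epsilon> r)"
    by (simp add: AE_all_countable)
  hence "AE \<omega> in M. \<omega> \<notin> ?E"
    by eventually_elim (use mean_tendsto_imp_stay[OF _ \<epsilon>] in blast)
  thus ?thesis using AE_iff_null_sets[OF E] by simp
qed

end

text \<open>If \<open>xs = 0\<close> and \<open>\<gamma> = 0\<close>, then \<open>lam 0 = 0\<close>
  keeps the process at zero almost surely, and the mean tends to \<open>xs\<close> with probability
  one; \<open>nondegenerate\<close> excludes this case.\<close>

theorem theorem6:
  fixes M :: "'a measure"
    and N :: "real \<Rightarrow> 'a \<Rightarrow> nat"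
    and lam lam' :: "real \<Rightarrow> real"
    and \<gamma> xs :: real
  assumes "prob_space M"
    and "\<And>x. 0 \<le> x \<Longrightarrow> 0 \<le> lam x"
    and "mono_on {0..} lam"
    and "\<And>x. 0 \<le> x \<Longrightarrow> (lam has_real_derivative lam' x) (at x within {0..})"
    and "continuous_on {0..} lam'"
    and "finite {x. 0 \<le> x \<and> x = lam x}"
    and "\<And>x. 0 \<le> x \<Longrightarrow> x = lam x \<Longrightarrow> lam' x < 1 \<or> lam' x > 1"
    and "0 \<le> \<gamma>"
    and "self_exciting_point_process M lam \<gamma> N"
    and "0 \<le> xs" and "xs = lam xs" and "lam' xs > 1"
    and nondegenerate: "xs \<noteq> 0 \<or> \<gamma> \<noteq> 0"
  shows "{\<omega> \<in> space M. ((\<lambda>t. real (N t \<omega>) / t) \<longlongrightarrow> xs) at_top} \<in> sets M \<and>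
         measure M {\<omega> \<in> space M. ((\<lambda>t. real (N t \<omega>) / t) \<longlongrightarrow> xs) at_top} = 0"
proof -
  have "continuous_on {0..} lam"
    using assms(4) by (intro DERIV_continuous_on) auto
  then interpret self_exciting M N lam \<gamma>
    using assms(1,2,8,9)
    by (auto simp: self_exciting_def self_exciting_axioms_def counting_process_def
        self_exciting_point_process_def)
  have "{\<omega> \<in> space M. ((\<lambda>t. real (N t \<omega>) / t) \<longlongrightarrow> xs) at_top} \<in> null_sets M"
    using assms(4)[OF assms(10)] assms(10-13) by (intro unstable_limit_null) auto
  thus ?thesis by (auto simp: null_sets_def measure_def)
qed

end
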